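(* Let $1<\alpha<2$, $0<d<1-\frac1\alpha$, $1<p<\alpha$, and let $g\in B_{\alpha,p}$. Then $$\int_{\mathbb{R}}g(x)\,dM_d(x)=\int_{\mathbb{R}}(I_-^dg)(x)\,dL_\alpha(x)$$ (equality of random variables in $L^p(\Omega,\mathbb{P})$).
   Context: $\{L_\alpha(t)\}_{t\in\mathbb{R}}$ is a symmetric $\alpha$-stable ($S\alpha S$) process with Lebesgue control measure on a probability space $(\Omega,\mathcal F,\mathbb P)$. The stable integral $f\mapsto\int_{\mathbb{R}}f\,dL_\alpha$ is the associated linear map from $L^\alpha(\mathbb{R})$ to random variables, with $\mathbb{E}[\exp\{i\theta\int f\,dL_\alpha\}]=\exp\{-|\theta|^\alpha\int_{\mathbb{R}}|f(x)|^\alpha dx\}$ for $\theta\in\mathbb{R}$; thus $L_\alpha(1)=\int\mathbf 1_{(0,1]}\,dL_\alpha$ has characteristic function $e^{-|\theta|^\alpha}$. The linear fractional stable motion is $M_d(t)=\frac{1}{\Gamma(d+1)}\int_{-\infty}^{\infty}[(t-x)_+^d-(-x)_+^d]\,dL_\alpha(x)$, $t\in\mathbb{R}$, with $u_+=\max\{u,0\}$. The right-sided Riemann-Liouville fractional integral is $(I_-^dg)(x)=\frac1{\Gamma(d)}\int_x^\infty g(t)(t-x)^{d-1}dt$. For $g\in L^1(\mathbb{R})\cap L^\alpha(\mathbb{R})$ one sets $\|g\|_{\alpha,p}=\left(\mathbb{E}|L_\alpha(1)|^p\right)^{1/p}\left(\int_{\mathbb{R}}|(I_-^dg)(x)|^\alpha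 dx\right)^{1/\alpha}$. $B_{\alpha,p}$ is the space $L^1(\mathbb{R})\cap L^\alpha(\mathbb{R})$ modulo the equivalence relation $f\sim g\iff\|f-g\|_{\alpha,p}=0$, with norm $\|\cdot\|_{\alpha,p}$. A simple function is $\phi=\sum_{i=1}^{n-1}a_i\mathbf 1_{(t_i,t_{i+1}]}$ with $a_i\in\mathbb{R}$ and $-\infty<t_1<\dots<t_n<\infty$; for it, $\int_{\mathbb{R}}\phi\,dM_d=I_{M_d}(\phi)=\sum_{i=1}^{n-1}a_i[M_d(t_{i+1})-M_d(t_i)]$. For general $g\in B_{\alpha,p}$, $\int_{\mathbb{R}}g\,dM_d=I_{M_d}(g)$ is the limit in $L^p(\Omega,\mathbb P)$ of $I_{M_d}(\phi_n)$ for any sequence of simple functions with $\|\phi_n-g\|_{\alpha,p}\to0$ (such sequences exist, and the limit exists and does not depend on the sequence). *)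

theory Defs
  imports "HOL-Probability.Probability"
begin

text \<open>
  Function spaces are given by representatives; elements that agree almost everywhere
  are not identified.
\<close>

definition Lp :: "'a measure \<Rightarrow> real \<Rightarrow> ('a \<Rightarrow> real) set" where
  "Lp M p = {f \<in> borel_measurable M. integrable M (\<lambda>x. \<bar>f x\<bar> powr p)}"

definition tendsto_Lp :: "'a measure \<Rightarrow> real \<Rightarrow> (nat \<Rightarrow> 'a \<Rightarrow> real) \<Rightarrow> ('a \<Rightarrow> real) \<Rightarrow> bool" where
  "tendsto_Lp M p X Y \<longleftrightarrow>
     (\<forall>k. X k \<in> Lp M p) \<and> Y \<in> Lp M p \<and>
     (\<lambda>k. \<integral>\<omega>. \<bar>X k \<omega> - Y \<omega>\<bar> powr p \<partial>M) \<longlonglongrightarrow> 0"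

text \<open>
  A symmetric stable process with Lebesgue control measure has independent increments over
  disjoint intervals, and its increment over an interval of length \<open>l\<close> has scale
  parameter \<open>l powr (1 / \<alpha>)\<close>.
\<close>

definition sas_process :: "'a measure \<Rightarrow> real \<Rightarrow> (real \<Rightarrow> 'a \<Rightarrow> real) \<Rightarrow> bool" where
  "sas_process M \<alpha> L \<longleftrightarrow>
     (\<forall>t. L t \<in> borel_measurable M) \<and>
     (AE \<omega> in M. L 0 \<omega> = 0) \<and>
     (\<forall>s t \<theta>. s < t \<longrightarrow>
        char (distr M borel (\<lambda>\<omega>. L t \<omega> - L s \<omega>)) \<theta>
          = complex_of_real (exp (- ((t - s) * \<bar>\<theta>\<bar> powr \<alpha>)))) \<and>
     (\<forall>n (t :: nat \<Rightarrow> real). strict_mono_on {..n} t \<longrightarrow>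
        prob_space.indep_vars M (\<lambda>_. borel) (\<lambda>i \<omega>. L (t (Suc i)) \<omega> - L (t i) \<omega>) {..<n})"

text \<open>
  \<open>J f\<close> stands for the stable integral of \<open>f\<close> with respect to \<open>L\<close>. Nothing is required
  of \<open>J\<close> outside \<open>Lp lborel \<alpha>\<close>, and linearity holds almost surely. These conditions
  determine \<open>J f\<close> up to null sets for every \<open>f \<in> Lp lborel \<alpha>\<close>.
\<close>

definition stable_integral ::
    "'a measure \<Rightarrow> real \<Rightarrow> (real \<Rightarrow> 'a \<Rightarrow> real) \<Rightarrow> ((real \<Rightarrow> real) \<Rightarrow> 'a \<Rightarrow> real) \<Rightarrow> bool" where
  "stable_integral M \<alpha> L J \<longleftrightarrow>
     (\<forall>f \<in> Lp lborel \<alpha>. J f \<in> borel_measurable M) \<and>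
     (\<forall>f \<in> Lp lborel \<alpha>. \<forall>g \<in> Lp lborel \<alpha>. \<forall>a b.
        AE \<omega> in M. J (\<lambda>x. a * f x + b * g x) \<omega> = a * J f \<omega> + b * J g \<omega>) \<and>
     (\<forall>f \<in> Lp lborel \<alpha>. \<forall>\<theta>.
        char (distr M borel (J f)) \<theta>
          = complex_of_real (exp (- (\<bar>\<theta>\<bar> powr \<alpha> * (\<integral>x. \<bar>f x\<bar> powr \<alpha> \<partial>lborel))))) \<and>
     (\<forall>s t. s < t \<longrightarrow> (AE \<omega> in M. J (indicator {s<..t}) \<omega> = L t \<omega> - L s \<omega>))"

text \<open>Linear fractional stable motion; note \<open>0 powr d = 0\<close>.\<close>

definition lfsm :: "((real \<Rightarrow> real) \<Rightarrow> 'a \<Rightarrow> real) \<Rightarrow> real \<Rightarrow> real \<Rightarrow> 'a \<Rightarrow> real" where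
  "lfsm J d t \<omega> =
     1 / Gamma (d + 1) * J (\<lambda>x. (max (t - x) 0) powr d - (max (- x) 0) powr d) \<omega>"

text \<open>
  Right-sided Riemann-Liouville fractional integral; the Bochner integral is \<open>0\<close> at the
  points \<open>x\<close> where the integrand is not integrable.
\<close>

definition RL_right :: "real \<Rightarrow> (real \<Rightarrow> real) \<Rightarrow> real \<Rightarrow> real" where
  "RL_right d g x = 1 / Gamma d * (LINT t:{x<..}|lborel. g t * (t - x) powr (d - 1))"

definition frac_norm ::
    "'a measure \<Rightarrow> (real \<Rightarrow> 'a \<Rightarrow> real) \<Rightarrow> real \<Rightarrow> real \<Rightarrow> real \<Rightarrow> (real \<Rightarrow> real) \<Rightarrow> real" where
  "frac_norm M L \<alpha> d p g =
     (\<integral>\<omega>. \<bar>L 1 \<omega>\<bar> powr p \<partial>M) powr (1 / p) *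
     (\<integral>x. \<bar>RL_right d g x\<bar> powr \<alpha> \<partial>lborel) powr (1 / \<alpha>)"

text \<open>
  A simple function is given by its data: the number \<open>n\<close> of nodes, the coefficients
  \<open>a 1, \<dots>, a (n - 1)\<close> and the nodes \<open>t 1 < \<dots> < t n\<close>.
\<close>

definition step_fun :: "nat \<Rightarrow> (nat \<Rightarrow> real) \<Rightarrow> (nat \<Rightarrow> real) \<Rightarrow> real \<Rightarrow> real" where
  "step_fun n a t x = (\<Sum>i = 1..<n. a i * indicator {t i<..t (i + 1)} x)"

definition step_integral ::
    "(real \<Rightarrow> 'a \<Rightarrow> real) \<Rightarrow> nat \<Rightarrow> (nat \<Rightarrow> real) \<Rightarrow> (nat \<Rightarrow> real) \<Rightarrow> 'a \<Rightarrow> real" where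
  "step_integral Z n a t \<omega> = (\<Sum>i = 1..<n. a i * (Z (t (i + 1)) \<omega> - Z (t i) \<omega>))"

definition step_approx ::
    "'a measure \<Rightarrow> (real \<Rightarrow> 'a \<Rightarrow> real) \<Rightarrow> real \<Rightarrow> real \<Rightarrow> real \<Rightarrow> (real \<Rightarrow> real) \<Rightarrow>
     (nat \<Rightarrow> nat) \<Rightarrow> (nat \<Rightarrow> nat \<Rightarrow> real) \<Rightarrow> (nat \<Rightarrow> nat \<Rightarrow> real) \<Rightarrow> bool" where
  "step_approx M L \<alpha> d p g n a t \<longleftrightarrow>
     (\<forall>k. 2 \<le> n k \<and> strict_mono_on {1..n k} (t k)) \<and>
     (\<lambda>k. frac_norm M L \<alpha> d p (\<lambda>x. step_fun (n k) (a k) (t k) x - g x)) \<longlonglongrightarrow> 0"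

definition has_lfsm_integral ::
    "'a measure \<Rightarrow> (real \<Rightarrow> 'a \<Rightarrow> real) \<Rightarrow> ((real \<Rightarrow> real) \<Rightarrow> 'a \<Rightarrow> real) \<Rightarrow>
     real \<Rightarrow> real \<Rightarrow> real \<Rightarrow> (real \<Rightarrow> real) \<Rightarrow> ('a \<Rightarrow> real) \<Rightarrow> bool" where
  "has_lfsm_integral M L J \<alpha> d p g X \<longleftrightarrow>
     (\<exists>n a t. step_approx M L \<alpha> d p g n a t) \<and>
     (\<forall>n a t. step_approx M L \<alpha> d p g n a t \<longrightarrow>
        tendsto_Lp M p (\<lambda>k. step_integral (lfsm J d) (n k) (a k) (t k)) X)"

text \<open>Determined up to null sets.\<close>

definition lfsm_integral ::
    "'a measure \<Rightarrow> (real \<Rightarrow> 'a \<Rightarrow> real) \<Rightarrow> ((real \<Rightarrow> real) \<Rightarrow> 'a \<Rightarrow> real) \<Rightarrow>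
     real \<Rightarrow> real \<Rightarrow> real \<Rightarrow> (real \<Rightarrow> real) \<Rightarrow> 'a \<Rightarrow> real" where
  "lfsm_integral M L J \<alpha> d p g = (SOME X. has_lfsm_integral M L J \<alpha> d p g X)"

end

theory Submission
  imports Defs
begin

text \<open>
  For \<open>g = indicator {s<..t}\<close> the fractional integral \<open>RL_right d g\<close> is exactly the kernel of the
  increment of the fractional motion over \<open>{s<..t}\<close>, so by linearity of the stable integral the
  identity holds for step functions. By Levy's uniqueness theorem \<open>J f\<close> is distributed like the
  \<open>\<alpha>\<close>-norm of \<open>f\<close> times \<open>L 1\<close>; hence the \<open>p\<close>-th moment of \<open>J (RL_right d \<phi>) - J (RL_right d g)\<close> is
  \<open>frac_norm (\<phi> - g) powr p\<close>, and convergence in \<open>frac_norm\<close> is convergence in \<open>L\<^sup>p\<close>. The moments are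
  finite because \<open>\<bar>x\<bar> powr p\<close> is, up to a constant, at most the integral of
  \<open>(1 - cos (\<theta> * x)) * \<theta> powr (- 1 - p)\<close> over \<open>\<theta> > 0\<close>, whose expectation involves only the
  characteristic function.

  Approximating step functions exist because \<open>RL_right d\<close> is continuous from \<open>L\<^sup>1 \<inter> L\<^sup>\<alpha>\<close> to \<open>L\<^sup>\<alpha>\<close>:
  the kernel \<open>u powr (d - 1)\<close> is integrable on \<open>{0<..1}\<close>, and its \<open>\<alpha>\<close>-th power is integrable on \<open>{1<..}\<close>
  since \<open>d < 1 - 1 / \<alpha>\<close>.
\<close>

subsection \<open>Integral inequalities\<close>

text \<open>The sum is at most twice the larger term. This crude bound stands in for Minkowski's
  inequality throughout: the constant \<open>2 powr p\<close> is harmless when a limit 0 or mere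
  finiteness is at stake.\<close>

lemma abs_add_powr_le:
  fixes a b p :: real
  assumes "0 \<le> p"
  shows "\<bar>a + b\<bar> powr p \<le> 2 powr p * (\<bar>a\<bar> powr p + \<bar>b\<bar> powr p)"
proof -
  have "\<bar>a + b\<bar> powr p \<le> (2 * max \<bar>a\<bar> \<bar>b\<bar>) powr p"
    by (rule powr_mono2) (use assms in auto)
  also have "\<dots> = 2 powr p * max \<bar>a\<bar> \<bar>b\<bar> powr p"
    by (simp add: powr_mult)
  also have "max \<bar>a\<bar> \<bar>b\<bar> powr p \<le> \<bar>a\<bar> powr p + \<bar>b\<bar> powr p"
    by (auto simp: max_def)
  finally show ?thesis by simp
qed

section \<open>Linear operations on the spaces \<open>Lp\<close>\<close>

lemma Lp_integrable: "f \<in> Lp M p \<Longrightarrow> integrable M (\<lambda>x. \<bar>f x\<bar> powr p)"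
  by (simp add: Lp_def)

lemma Lp_scale:
  assumes "f \<in> Lp M p"
  shows "(\<lambda>x. c * f x) \<in> Lp M p"
  using assms by (auto simp: Lp_def abs_mult powr_mult)

lemma Lp_add:
  assumes p: "0 \<le> p" and f: "f \<in> Lp M p" and g: "g \<in> Lp M p"
  shows "(\<lambda>x. f x + g x) \<in> Lp M p"
    and "(\<integral>x. \<bar>f x + g x\<bar> powr p \<partial>M)
      \<le> 2 powr p * ((\<integral>x. \<bar>f x\<bar> powr p \<partial>M) + (\<integral>x. \<bar>g x\<bar> powr p \<partial>M))"
proof -
  have [measurable]: "f \<in> borel_measurable M" "g \<in> borel_measurable M"
    using f g by (simp_all add: Lp_def)
  have *: "integrable M (\<lambda>x. 2 powr p * (\<bar>f x\<bar> powr p + \<bar>g x\<bar> powr p))"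
    using f g by (auto simp: Lp_def)
  have i: "integrable M (\<lambda>x. \<bar>f x + g x\<bar> powr p)"
    by (rule Bochner_Integration.integrable_bound[OF *])
      (use abs_add_powr_le[OF p] in \<open>auto intro!: AE_I2\<close>)
  then show "(\<lambda>x. f x + g x) \<in> Lp M p"
    by (simp add: Lp_def)
  have "(\<integral>x. \<bar>f x + g x\<bar> powr p \<partial>M) \<le> (\<integral>x. 2 powr p * (\<bar>f x\<bar> powr p + \<bar>g x\<bar> powr p) \<partial>M)"
    by (rule integral_mono[OF i *]) (use abs_add_powr_le[OF p] in auto)
  also have "\<dots> = 2 powr p * ((\<integral>x. \<bar>f x\<bar> powr p \<partial>M) + (\<integral>x. \<bar>g x\<bar> powr p \<partial>M))"
    using f g by (simp add: Lp_def)
  finally show "(\<integral>x. \<bar>f x + g x\<bar> powr p \<partial>M)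
      \<le> 2 powr p * ((\<integral>x. \<bar>f x\<bar> powr p \<partial>M) + (\<integral>x. \<bar>g x\<bar> powr p \<partial>M))" .
qed

lemma Lp_diff:
  assumes "0 \<le> p" "f \<in> Lp M p" "g \<in> Lp M p"
  shows "(\<lambda>x. f x - g x) \<in> Lp M p"
  using Lp_add(1)[OF assms(1,2) Lp_scale[OF assms(3), of "-1"]] by simp

lemma Lp_zero: "(\<lambda>x. 0) \<in> Lp M p"
  by (simp add: Lp_def)

lemma Lp_sum:
  assumes "0 \<le> p" "\<And>i. i \<in> I \<Longrightarrow> f i \<in> Lp M p"
  shows "(\<lambda>x. \<Sum>i\<in>I. c i * f i x) \<in> Lp M p"
  using assms(2)
proof (induction I rule: infinite_finite_induct)
  case (insert i I)
  then show ?case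
    using Lp_add(1)[OF assms(1) Lp_scale[of "f i" M p "c i"], of "\<lambda>x. \<Sum>i\<in>I. c i * f i x"] by simp
qed (simp_all add: Lp_zero)

section \<open>Power functions near zero and at infinity\<close>

lemma has_bochner_integral_powr_near_0:
  fixes e c :: real
  assumes "- 1 < e" "0 \<le> c"
  shows "has_bochner_integral lborel (\<lambda>u. indicator {0<..c} u * u powr e) (c powr (e + 1) / (e + 1))"
proof -
  have "((\<lambda>u. u powr e) has_integral c powr (e + 1) / (e + 1)) {0..c}"
    using has_integral_powr_from_0[OF assms] .
  then have "((\<lambda>u. u powr e) has_integral c powr (e + 1) / (e + 1)) {0<..c}"
    by (subst (asm) has_integral_spike_set_eq[where T = "{0<..c}"]) (auto intro!: negligible_subset[OF negligible_sing[of 0]])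
  then have *: "((\<lambda>u. indicator {0<..c} u * u powr e) has_integral c powr (e + 1) / (e + 1)) UNIV"
    by (subst (asm) has_integral_restrict_UNIV[symmetric])
      (simp add: indicator_times_eq_if(1)[of "{0<..c}" _ "\<lambda>u. u powr e", simplified])
  have "(\<integral>\<^sup>+u. ennreal (indicator {0<..c} u * u powr e) \<partial>lborel) = ennreal (c powr (e + 1) / (e + 1))"
    by (rule nn_integral_has_integral_lborel[OF _ _ *]) auto
  then show ?thesis
    using assms by (intro has_bochner_integral_nn_integral) auto
qed

lemma integrable_powr_at_infinity:
  fixes e :: real
  assumes "e < - 1"
  shows "integrable lborel (\<lambda>u. indicator {1<..} u * u powr e)"
proof -
  have "((\<lambda>u. u powr e) has_integral -(1 powr (e + 1)) / (e + 1)) {1..}"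
    using has_integral_powr_to_inf[OF assms, of 1] by simp
  then have "((\<lambda>u. u powr e) has_integral -(1 powr (e + 1)) / (e + 1)) {1<..}"
    by (subst (asm) has_integral_spike_set_eq[where T = "{1<..}"]) (auto intro!: negligible_subset[OF negligible_sing[of 1]])
  then have *: "((\<lambda>u. indicator {1<..} u * u powr e) has_integral -(1 powr (e + 1)) / (e + 1)) UNIV"
    by (subst (asm) has_integral_restrict_UNIV[symmetric])
      (simp add: indicator_times_eq_if(1)[of "{1<..}" _ "\<lambda>u. u powr e", simplified])
  have "(\<integral>\<^sup>+u. ennreal (indicator {1<..} u * u powr e) \<partial>lborel) = ennreal (-(1 powr (e + 1)) / (e + 1))"
    by (rule nn_integral_has_integral_lborel[OF _ _ *]) auto
  then show ?thesis
    by (intro integrableI_nonneg) auto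
qed

text \<open>Jensen's inequality for the power \<alpha> and the weight \<open>F\<close>. Since
  \<open>F\<close> is not normalised, its total mass enters with exponent
  \<open>\<alpha> - 1\<close>. Integrability of \<open>F x * h x\<close> comes from
  \<open>h \<le> 1 + h powr \<alpha>\<close>.\<close>

lemma weighted_powr_mean:
  fixes F h :: "'b \<Rightarrow> real"
  assumes \<alpha>: "1 < \<alpha>" and F: "integrable M F" "\<And>x. 0 \<le> F x"
    and h[measurable]: "h \<in> borel_measurable M" and h0: "\<And>x. 0 \<le> h x"
    and Fh: "integrable M (\<lambda>x. F x * h x powr \<alpha>)"
  shows "integrable M (\<lambda>x. F x * h x)"
    and "(\<integral>x. F x * h x \<partial>M) powr \<alpha> \<le> (\<integral>x. F x \<partial>M) powr (\<alpha> - 1) * (\<integral>x. F x * h x powr \<alpha> \<partial>M)"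
proof -
  have [measurable]: "F \<in> borel_measurable M" using F(1) by simp
  have le: "h x \<le> 1 + h x powr \<alpha>" for x
  proof (cases "h x \<le> 1")
    case False
    then have "h x powr 1 \<le> h x powr \<alpha>" by (intro powr_mono) (use \<alpha> in auto)
    then show ?thesis using False by simp
  next
    case True
    then show ?thesis by (smt (verit) powr_ge_zero)
  qed
  show i: "integrable M (\<lambda>x. F x * h x)"
  proof (rule Bochner_Integration.integrable_bound)
    show "integrable M (\<lambda>x. F x + F x * h x powr \<alpha>)"
      using F Fh by auto
    show "AE x in M. norm (F x * h x) \<le> norm (F x + F x * h x powr \<alpha>)"
    proof (rule AE_I2)
      fix x
      have "F x * h x \<le> F x * (1 + h x powr \<alpha>)"
        by (intro mult_left_mono le F)
      then show "norm (F x * h x) \<le> norm (F x + F x * h x powr \<alpha>)"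
        using F(2)[of x] h0[of x] by (simp add: algebra_simps)
    qed
  qed simp
  define A where "A = (\<integral>x. F x \<partial>M)"
  define I where "I = (\<integral>x. F x * h x \<partial>M)"
  define K where "K = (\<integral>x. F x * h x powr \<alpha> \<partial>M)"
  have A0: "0 \<le> A" unfolding A_def by (rule integral_nonneg_AE) (use F in auto)
  have I0: "0 \<le> I" unfolding I_def by (rule integral_nonneg_AE) (use F h0 in auto)
  have K0: "0 \<le> K" unfolding K_def by (rule integral_nonneg_AE) (use F in auto)
  have "I powr \<alpha> \<le> A powr (\<alpha> - 1) * K"
  proof (cases "I = 0")
    case True
    then show ?thesis using A0 K0 by simp
  next
    case False
    have "A \<noteq> 0"
    proof
      assume "A = 0"
      then have "AE x in M. F x = 0"
        unfolding A_def using F by (simp add: integral_nonneg_eq_0_iff_AE)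
      then have "I = (\<integral>x. 0 \<partial>M)"
        unfolding I_def by (intro integral_cong_AE) auto
      then show False using False by simp
    qed
    then have Ap: "0 < A" and Ip: "0 < I" using A0 I0 False by auto
    define m where "m = I / A"
    have mp: "0 < m" using Ap Ip by (simp add: m_def)
    define q where "q = \<alpha> / (\<alpha> - 1)"
    have q: "1 < q" "1 / \<alpha> + 1 / q = 1"
      using \<alpha> by (auto simp: q_def field_simps)
    \<comment> \<open>Young's inequality at the weighted mean \<open>m\<close> plays the role of the tangent line in Jensen's inequality\<close>
    have young: "F x * h x * m powr (\<alpha> - 1) \<le> F x * h x powr \<alpha> / \<alpha> + F x * (m powr \<alpha> / q)" for x
    proof -
      have "h x * m powr (\<alpha> - 1) \<le> h x powr \<alpha> / \<alpha> + (m powr (\<alpha> - 1)) powr q / q"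
        by (rule Youngs_inequality) (use \<alpha> q h0 in auto)
      also have "(m powr (\<alpha> - 1)) powr q = m powr \<alpha>"
        using \<alpha> by (simp add: powr_powr q_def)
      finally have "F x * (h x * m powr (\<alpha> - 1)) \<le> F x * (h x powr \<alpha> / \<alpha> + m powr \<alpha> / q)"
        by (intro mult_left_mono F)
      then show ?thesis by (simp add: algebra_simps)
    qed
    have "I * m powr (\<alpha> - 1) = (\<integral>x. F x * h x * m powr (\<alpha> - 1) \<partial>M)"
      unfolding I_def by simp
    also have "\<dots> \<le> (\<integral>x. F x * h x powr \<alpha> / \<alpha> + F x * (m powr \<alpha> / q) \<partial>M)"
      by (rule integral_mono[OF _ _ young]) (use i Fh F in auto)
    also have "\<dots> = K / \<alpha> + A * (m powr \<alpha> / q)"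
      unfolding K_def A_def using Fh F by simp
    finally have 1: "I * m powr (\<alpha> - 1) \<le> K / \<alpha> + A * (m powr \<alpha> / q)" .
    have 2: "I * m powr (\<alpha> - 1) = A * m powr \<alpha>"
      using Ap mp by (simp add: powr_diff) (simp add: m_def)
    have 3: "1 / q = 1 - 1 / \<alpha>" using q(2) by simp
    \<comment> \<open>The choice of \<open>m\<close> makes the left side of \<open>1\<close> equal
      to \<open>A * m powr \<alpha>\<close>. Moving its share \<open>1 / q\<close> across leaves the
      share \<open>1 / \<alpha>\<close>, so the constants of Young's inequality cancel.\<close>
    have "A * m powr \<alpha> \<le> K / \<alpha> + A * m powr \<alpha> * (1 / q)" using 1 2 by simp
    then have "A * m powr \<alpha> / \<alpha> \<le> K / \<alpha>"
      unfolding 3 by (simp add: algebra_simps)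
    then have 4: "A * m powr \<alpha> \<le> K" using \<alpha> by (simp add: divide_le_cancel)
    have "I powr \<alpha> = A powr (\<alpha> - 1) * (A * m powr \<alpha>)"
      using Ap Ip by (simp add: m_def powr_divide powr_diff)
    also have "\<dots> \<le> A powr (\<alpha> - 1) * K"
      by (intro mult_left_mono 4) auto
    finally show ?thesis .
  qed
  then show "(\<integral>x. F x * h x \<partial>M) powr \<alpha> \<le> (\<integral>x. F x \<partial>M) powr (\<alpha> - 1) * (\<integral>x. F x * h x powr \<alpha> \<partial>M)"
    by (simp add: A_def I_def K_def)
qed

text \<open>Both halves of the convolution with \<open>u powr (d - 1)\<close> are instances: the near part with the
  kernel as weight and translates of \<open>g\<close> as \<open>H\<close>, the far part with \<open>\<bar>g\<bar>\<close> as weight and translates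
  of the kernel as \<open>H\<close>.\<close>

lemma integral_mixture_powr_le:
  fixes F :: "real \<Rightarrow> real" and H :: "real \<Rightarrow> real \<Rightarrow> real"
  assumes \<alpha>: "1 < \<alpha>" and F: "integrable lborel F" "\<And>x. 0 \<le> F x"
    and H[measurable]: "(\<lambda>(t, x). H t x) \<in> borel_measurable (borel \<Otimes>\<^sub>M borel)"
    and H0: "\<And>t x. 0 \<le> H t x"
    and B: "\<And>t. (\<integral>\<^sup>+x. ennreal (H t x powr \<alpha>) \<partial>lborel) = ennreal B" "0 \<le> B"
  defines "P \<equiv> \<lambda>x. \<integral>t. F t * H t x \<partial>lborel"
  shows "AE x in lborel. integrable lborel (\<lambda>t. F t * H t x)"
    and "P \<in> Lp lborel \<alpha>"
    and "(\<integral>x. \<bar>P x\<bar> powr \<alpha> \<partial>lborel) \<le> (\<integral>t. F t \<partial>lborel) powr \<alpha> * B"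
proof -
  have Fm[measurable]: "F \<in> borel_measurable borel" using F(1) by simp
  define A where "A = (\<integral>t. F t \<partial>lborel)"
  have A0: "0 \<le> A" unfolding A_def by (rule integral_nonneg_AE) (use F in auto)
  \<comment> \<open>Tonelli: integrating in \<open>x\<close> first gives \<open>B\<close> for every
    \<open>t\<close>, so the double integral is the mass of \<open>F\<close> times \<open>B\<close>.
    Its finiteness yields integrability in \<open>t\<close> for almost every
    \<open>x\<close>.\<close>
  have "(\<integral>\<^sup>+x. (\<integral>\<^sup>+t. ennreal (F t * H t x powr \<alpha>) \<partial>lborel) \<partial>lborel)
      = (\<integral>\<^sup>+t. (\<integral>\<^sup>+x. ennreal (F t * H t x powr \<alpha>) \<partial>lborel) \<partial>lborel)"
    by (rule lborel_pair.Fubini') simp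
  also have "\<dots> = (\<integral>\<^sup>+t. ennreal (F t) * ennreal B \<partial>lborel)"
    by (rule nn_integral_cong) (simp add: ennreal_mult F nn_integral_cmult B)
  also have "\<dots> = ennreal A * ennreal B"
    unfolding A_def using F by (simp add: nn_integral_multc nn_integral_eq_integral)
  finally have fub: "(\<integral>\<^sup>+x. (\<integral>\<^sup>+t. ennreal (F t * H t x powr \<alpha>) \<partial>lborel) \<partial>lborel) = ennreal A * ennreal B" .
  have "AE x in lborel. (\<integral>\<^sup>+t. ennreal (F t * H t x powr \<alpha>) \<partial>lborel) \<noteq> \<infinity>"
  proof (rule nn_integral_noteq_infinite)
    show "(\<lambda>x. \<integral>\<^sup>+t. ennreal (F t * H t x powr \<alpha>) \<partial>lborel) \<in> borel_measurable lborel"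
      by measurable
    show "(\<integral>\<^sup>+x. (\<integral>\<^sup>+t. ennreal (F t * H t x powr \<alpha>) \<partial>lborel) \<partial>lborel) \<noteq> \<infinity>"
      using A0 B by (simp add: fub ennreal_mult_eq_top_iff)
  qed
  then have ae: "AE x in lborel. integrable lborel (\<lambda>t. F t * H t x powr \<alpha>)"
    by eventually_elim (rule integrableI_nonneg, auto simp: F less_top)
  show ae2: "AE x in lborel. integrable lborel (\<lambda>t. F t * H t x)"
    using ae by eventually_elim (rule weighted_powr_mean(1)[OF \<alpha> F], auto simp: H0)
  have Pm[measurable]: "P \<in> borel_measurable borel"
    unfolding P_def by measurable
  have P0: "0 \<le> P x" for x
    unfolding P_def by (rule integral_nonneg_AE) (use F H0 in auto)
  have le: "AE x in lborel. ennreal (\<bar>P x\<bar> powr \<alpha>)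
      \<le> ennreal (A powr (\<alpha> - 1)) * (\<integral>\<^sup>+t. ennreal (F t * H t x powr \<alpha>) \<partial>lborel)"
    using ae
  proof eventually_elim
    case (elim x)
    have "\<bar>P x\<bar> powr \<alpha> \<le> A powr (\<alpha> - 1) * (\<integral>t. F t * H t x powr \<alpha> \<partial>lborel)"
      using weighted_powr_mean(2)[OF \<alpha> F _ _ elim] P0 by (simp add: H0 P_def A_def)
    also have "ennreal \<dots> = ennreal (A powr (\<alpha> - 1)) * (\<integral>\<^sup>+t. ennreal (F t * H t x powr \<alpha>) \<partial>lborel)"
      using elim F by (subst ennreal_mult) (auto simp: nn_integral_eq_integral intro!: integral_nonneg_AE)
    finally show ?case by (simp add: ennreal_leI)
  qed
  have "(\<integral>\<^sup>+x. ennreal (\<bar>P x\<bar> powr \<alpha>) \<partial>lborel)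
      \<le> (\<integral>\<^sup>+x. ennreal (A powr (\<alpha> - 1)) * (\<integral>\<^sup>+t. ennreal (F t * H t x powr \<alpha>) \<partial>lborel) \<partial>lborel)"
    by (rule nn_integral_mono_AE[OF le])
  also have "\<dots> = ennreal (A powr (\<alpha> - 1)) * (ennreal A * ennreal B)"
    by (subst nn_integral_cmult) (auto simp: fub)
  also have "\<dots> = ennreal (A powr \<alpha> * B)"
  proof -
    have "A powr \<alpha> = A powr (\<alpha> - 1) * A"
      using A0 \<alpha> by (cases "A = 0") (auto simp: powr_diff)
    then show ?thesis using A0 B by (simp add: ennreal_mult mult.assoc)
  qed
  finally have bound: "(\<integral>\<^sup>+x. ennreal (\<bar>P x\<bar> powr \<alpha>) \<partial>lborel) \<le> ennreal (A powr \<alpha> * B)" .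
  have int: "integrable lborel (\<lambda>x. \<bar>P x\<bar> powr \<alpha>)"
    by (rule integrableI_nonneg) (use bound in \<open>auto simp: le_less_trans\<close>)
  then show "P \<in> Lp lborel \<alpha>"
    by (simp add: Lp_def)
  show "(\<integral>x. \<bar>P x\<bar> powr \<alpha> \<partial>lborel) \<le> (\<integral>t. F t \<partial>lborel) powr \<alpha> * B"
    using bound B by (simp add: nn_integral_eq_integral int A_def[symmetric])
qed

subsection \<open>The fractional integral\<close>

text \<open>Distance 1 separates the singularity of the kernel from its slow decay. For the exponent
  \<open>d - 1\<close> the near part is integrable and the far part has an integrable power
  \<alpha>, but neither condition holds for the whole kernel.\<close>

lemma RL_right_integrand:
  "indicator {x<..} t * (g t * (t - x) powr e)
    = g t * (indicator {0<..1} (t - x) * (t - x) powr e)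
      + g t * (indicator {1<..} (t - x) * (t - x) powr e)" for g :: "real \<Rightarrow> real"
  by (auto simp: indicator_def)

text \<open>The domain \<open>{x<..}\<close> varies with \<open>x\<close>; as an indicator of
  \<open>{0<..}\<close> at \<open>t - x\<close> it becomes part of a jointly measurable
  integrand.\<close>

lemma RL_right_measurable:
  assumes [measurable]: "g \<in> borel_measurable borel"
  shows "RL_right d g \<in> borel_measurable borel"
proof -
  have "(\<lambda>x. LINT t|lborel. indicator {0<..} (t - x) * (g t * (t - x) powr (d - 1))) \<in> borel_measurable borel"
    by measurable
  moreover have "RL_right d g = (\<lambda>x. 1 / Gamma d * (LINT t|lborel. indicator {0<..} (t - x) * (g t * (t - x) powr (d - 1))))"
    by (auto simp: fun_eq_iff RL_right_def set_lebesgue_integral_def indicator_def)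
  ultimately show ?thesis by simp
qed

text \<open>The substitution \<open>t = x + u\<close> exhibits \<open>P\<close> as a mixture of
  translates of \<open>\<bar>g\<bar>\<close>. All translates have the same \<alpha>-norm, and the
  near kernel has mass \<open>1 / d\<close>.\<close>

lemma convolution_near_part:
  assumes \<alpha>: "1 < \<alpha>" and d: "0 < d" and g: "g \<in> Lp lborel \<alpha>"
  defines "P \<equiv> \<lambda>x. \<integral>t. \<bar>g t\<bar> * (indicator {0<..1} (t - x) * (t - x) powr (d - 1)) \<partial>lborel"
  shows "AE x in lborel. integrable lborel (\<lambda>t. \<bar>g t\<bar> * (indicator {0<..1} (t - x) * (t - x) powr (d - 1)))"
    and "P \<in> Lp lborel \<alpha>"
    and "(\<integral>x. \<bar>P x\<bar> powr \<alpha> \<partial>lborel) \<le> (1 / d) powr \<alpha> * (\<integral>x. \<bar>g x\<bar> powr \<alpha> \<partial>lborel)"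
proof -
  have gm[measurable]: "g \<in> borel_measurable borel" using g by (simp add: Lp_def)
  let ?F = "\<lambda>u::real. indicator {0<..1} u * u powr (d - 1)"
  have F: "has_bochner_integral lborel ?F (1 / d)"
    using has_bochner_integral_powr_near_0[of "d - 1" 1] d by simp
  define H where "H = (\<lambda>u x. \<bar>g (x + u)\<bar>)"
  have eq: "(\<integral>u. ?F u * H u x \<partial>lborel) = P x" for x
    unfolding P_def H_def
    by (subst (2) lborel_integral_real_affine[of 1 _ x]) (auto simp: mult.commute)
  have int: "integrable lborel (\<lambda>t. \<bar>g t\<bar> * ?F (t - x)) \<longleftrightarrow> integrable lborel (\<lambda>u. ?F u * H u x)" for x
    unfolding H_def
    by (subst lborel_integrable_real_affine_iff[symmetric, of 1 _ x]) (auto simp: mult.commute)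
  have B: "(\<integral>\<^sup>+x. ennreal (H t x powr \<alpha>) \<partial>lborel) = ennreal (\<integral>x. \<bar>g x\<bar> powr \<alpha> \<partial>lborel)" for t
  proof -
    have "(\<integral>\<^sup>+x. ennreal (H t x powr \<alpha>) \<partial>lborel) = (\<integral>\<^sup>+x. ennreal (\<bar>g x\<bar> powr \<alpha>) \<partial>lborel)"
      unfolding H_def by (subst (2) nn_integral_real_affine[of _ 1 t]) (auto simp: add.commute)
    also have "\<dots> = ennreal (\<integral>x. \<bar>g x\<bar> powr \<alpha> \<partial>lborel)"
      using g by (intro nn_integral_eq_integral) (auto simp: Lp_def)
    finally show ?thesis .
  qed
  have F1: "integrable lborel ?F" and F2: "integral\<^sup>L lborel ?F = 1 / d"
    using F by (auto simp: has_bochner_integral_iff)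
  have Hm: "(\<lambda>(t, x). H t x) \<in> borel_measurable (borel \<Otimes>\<^sub>M borel)"
    unfolding H_def by measurable
  note mix = integral_mixture_powr_le[OF \<alpha> F1 _ Hm _ B]
  show "AE x in lborel. integrable lborel (\<lambda>t. \<bar>g t\<bar> * ?F (t - x))"
    unfolding int by (rule mix(1)) (auto simp: H_def)
  show "P \<in> Lp lborel \<alpha>"
    unfolding eq[abs_def, symmetric] by (rule mix(2)) (auto simp: H_def)
  show "(\<integral>x. \<bar>P x\<bar> powr \<alpha> \<partial>lborel) \<le> (1 / d) powr \<alpha> * (\<integral>x. \<bar>g x\<bar> powr \<alpha> \<partial>lborel)"
    unfolding eq[abs_def, symmetric] F2[symmetric] by (rule mix(3)) (auto simp: H_def)
qed

text \<open>Here the kernel is translated and \<open>\<bar>g\<bar>\<close> is the weight, so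
  integrability of \<open>g\<close> replaces integrability of the kernel. The reflection
  \<open>x \<mapsto> t - x\<close> shows that \<open>B\<close> does not depend on the
  translate.\<close>

lemma convolution_far_part:
  assumes \<alpha>: "1 < \<alpha>" and d: "d < 1 - 1 / \<alpha>" and g: "g \<in> Lp lborel 1"
  defines "P \<equiv> \<lambda>x. \<integral>t. \<bar>g t\<bar> * (indicator {1<..} (t - x) * (t - x) powr (d - 1)) \<partial>lborel"
    and "B \<equiv> (\<integral>u. indicator {1<..} u * u powr ((d - 1) * \<alpha>) \<partial>lborel)"
  shows "AE x in lborel. integrable lborel (\<lambda>t. \<bar>g t\<bar> * (indicator {1<..} (t - x) * (t - x) powr (d - 1)))"
    and "P \<in> Lp lborel \<alpha>"
    and "(\<integral>x. \<bar>P x\<bar> powr \<alpha> \<partial>lborel) \<le> (\<integral>x. \<bar>g x\<bar> \<partial>lborel) powr \<alpha> * B"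
proof -
  have gm[measurable]: "g \<in> borel_measurable borel" using g by (simp add: Lp_def)
  let ?k = "\<lambda>u::real. indicator {1<..} u * u powr (d - 1)"
  \<comment> \<open>The upper bound on \<open>d\<close> is exactly the integrability of the
    \<alpha>-th power of the kernel at infinity.\<close>
  have "(d - 1) * \<alpha> < - 1" using \<alpha> d by (simp add: field_simps)
  then have iB: "integrable lborel (\<lambda>u::real. indicator {1<..} u * u powr ((d - 1) * \<alpha>))"
    by (rule integrable_powr_at_infinity)
  have kp: "?k u powr \<alpha> = indicator {1<..} u * u powr ((d - 1) * \<alpha>)" for u
    by (auto simp: indicator_def powr_powr)
  have F1: "integrable lborel (\<lambda>t. \<bar>g t\<bar>)" using g by (simp add: Lp_def)
  have B: "(\<integral>\<^sup>+x. ennreal (?k (t - x) powr \<alpha>) \<partial>lborel) = ennreal B" for t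
  proof -
    have "(\<integral>\<^sup>+x. ennreal (?k (t - x) powr \<alpha>) \<partial>lborel) = (\<integral>\<^sup>+x. ennreal (?k x powr \<alpha>) \<partial>lborel)"
      by (subst (2) nn_integral_real_affine[of _ "-1" t]) auto
    also have "\<dots> = ennreal B"
      unfolding kp B_def using iB by (intro nn_integral_eq_integral) auto
    finally show ?thesis .
  qed
  have B0: "0 \<le> B" unfolding B_def by (rule integral_nonneg_AE) auto
  have Hm: "(\<lambda>(t, x). ?k (t - x)) \<in> borel_measurable (borel \<Otimes>\<^sub>M borel)"
    by measurable
  note mix = integral_mixture_powr_le[OF \<alpha> F1 _ Hm _ B B0]
  show "AE x in lborel. integrable lborel (\<lambda>t. \<bar>g t\<bar> * ?k (t - x))"
    by (rule mix(1)) auto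
  show "P \<in> Lp lborel \<alpha>"
    unfolding P_def by (rule mix(2)) auto
  show "(\<integral>x. \<bar>P x\<bar> powr \<alpha> \<partial>lborel) \<le> (\<integral>x. \<bar>g x\<bar> \<partial>lborel) powr \<alpha> * B"
    unfolding P_def by (rule mix(3)) auto
qed

text \<open>Where the integral diverges, \<open>RL_right\<close> takes the default value 0 and
  additivity in \<open>g\<close> can fail. The exceptional points form a null set, so
  \<open>RL_right\<close> is additive almost everywhere.\<close>

lemma RL_right_integrable_AE:
  assumes \<alpha>: "1 < \<alpha>" and d: "0 < d" "d < 1 - 1 / \<alpha>"
    and g: "g \<in> Lp lborel 1" "g \<in> Lp lborel \<alpha>"
  shows "AE x in lborel. set_integrable lborel {x<..} (\<lambda>t. g t * (t - x) powr (d - 1))"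
  using convolution_near_part(1)[OF \<alpha> d(1) g(2)] convolution_far_part(1)[OF \<alpha> d(2) g(1)]
proof eventually_elim
  case (elim x)
  have [measurable]: "g \<in> borel_measurable borel" using g by (simp add: Lp_def)
  from elim(1) have 1: "integrable lborel (\<lambda>t. g t * (indicator {0<..1} (t - x) * (t - x) powr (d - 1)))"
    by (rule Bochner_Integration.integrable_bound) (auto intro!: AE_I2 simp: abs_mult)
  from elim(2) have 2: "integrable lborel (\<lambda>t. g t * (indicator {1<..} (t - x) * (t - x) powr (d - 1)))"
    by (rule Bochner_Integration.integrable_bound) (auto intro!: AE_I2 simp: abs_mult)
  show ?case
    unfolding set_integrable_def real_scaleR_def RL_right_integrand using 1 2 by auto
qed

text \<open>One constant \<open>C\<close> serves all \<open>g\<close>, so functions small in both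
  norms have small fractional integrals. Near and far parts contribute the two terms on the
  right.\<close>

lemma RL_right_Lp_bound:
  fixes \<alpha> d :: real
  assumes \<alpha>: "1 < \<alpha>" and d: "0 < d" "d < 1 - 1 / \<alpha>"
  obtains C where "0 \<le> C"
    and "\<And>g. g \<in> Lp lborel 1 \<Longrightarrow> g \<in> Lp lborel \<alpha> \<Longrightarrow> RL_right d g \<in> Lp lborel \<alpha>"
    and "\<And>g. g \<in> Lp lborel 1 \<Longrightarrow> g \<in> Lp lborel \<alpha> \<Longrightarrow>
      (\<integral>x. \<bar>RL_right d g x\<bar> powr \<alpha> \<partial>lborel)
        \<le> C * ((\<integral>x. \<bar>g x\<bar> \<partial>lborel) powr \<alpha> + (\<integral>x. \<bar>g x\<bar> powr \<alpha> \<partial>lborel))"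
proof
  define B where "B = (\<integral>u. indicator {1<..} u * u powr ((d - 1) * \<alpha>) \<partial>lborel)"
  have B0: "0 \<le> B" unfolding B_def by (rule integral_nonneg_AE) auto
  \<comment> \<open>The factors come from the prefactor of \<open>RL_right\<close>, from splitting a
    sum in \<open>Lp_add\<close>, and from the larger of the constants of the two parts.\<close>
  define C where "C = (1 / Gamma d) powr \<alpha> * (2 powr \<alpha> * max ((1 / d) powr \<alpha>) B)"
  show "0 \<le> C" using B0 by (simp add: C_def)
  fix g :: "real \<Rightarrow> real" assume g: "g \<in> Lp lborel 1" "g \<in> Lp lborel \<alpha>"
  have [measurable]: "g \<in> borel_measurable borel" using g by (simp add: Lp_def)
  note [measurable] = RL_right_measurable[of g d]
  define P where "P = (\<lambda>x. \<integral>t. \<bar>g t\<bar> * (indicator {0<..1} (t - x) * (t - x) powr (d - 1)) \<partial>lborel)"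
  define Q where "Q = (\<lambda>x. \<integral>t. \<bar>g t\<bar> * (indicator {1<..} (t - x) * (t - x) powr (d - 1)) \<partial>lborel)"
  note near = convolution_near_part[OF \<alpha> d(1) g(2), folded P_def]
  note far = convolution_far_part[OF \<alpha> d(2) g(1), folded Q_def B_def]
  have near3: "(\<integral>x. \<bar>P x\<bar> powr \<alpha> \<partial>lborel) \<le> (1 / d) powr \<alpha> * (\<integral>x. \<bar>g x\<bar> powr \<alpha> \<partial>lborel)"
    using near(3) by (simp only: P_def)
  have far3: "(\<integral>x. \<bar>Q x\<bar> powr \<alpha> \<partial>lborel) \<le> (\<integral>x. \<bar>g x\<bar> \<partial>lborel) powr \<alpha> * B"
    using far(3) by (simp only: Q_def)
  have Gd: "0 < Gamma d" using d by (simp add: Gamma_real_pos)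
  have dom: "AE x in lborel. \<bar>RL_right d g x\<bar> powr \<alpha> \<le> (1 / Gamma d) powr \<alpha> * \<bar>P x + Q x\<bar> powr \<alpha>"
    using near(1) far(1) RL_right_integrable_AE[OF \<alpha> d g]
  proof eventually_elim
    case (elim x)
    have "\<bar>LINT t:{x<..}|lborel. g t * (t - x) powr (d - 1)\<bar>
        \<le> (\<integral>t. \<bar>indicator {x<..} t * (g t * (t - x) powr (d - 1))\<bar> \<partial>lborel)"
      unfolding set_lebesgue_integral_def real_scaleR_def by (rule integral_abs_bound)
    also have "\<dots> = (\<integral>t. indicator {x<..} t * (\<bar>g t\<bar> * (t - x) powr (d - 1)) \<partial>lborel)"
      by (intro Bochner_Integration.integral_cong) (auto simp: abs_mult)
    also have "\<dots> = P x + Q x"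
      unfolding RL_right_integrand[of x _ "\<lambda>t. \<bar>g t\<bar>"] P_def Q_def
      using elim by (intro Bochner_Integration.integral_add)
    finally have le: "\<bar>RL_right d g x\<bar> \<le> 1 / Gamma d * \<bar>P x + Q x\<bar>"
      using Gd unfolding RL_right_def abs_mult by (intro mult_mono) auto
    have "\<bar>RL_right d g x\<bar> powr \<alpha> \<le> (1 / Gamma d * \<bar>P x + Q x\<bar>) powr \<alpha>"
      by (rule powr_mono2) (use \<alpha> le in auto)
    then show ?case using Gd by (subst (asm) powr_mult) auto
  qed
  have "0 \<le> \<alpha>" using \<alpha> by simp
  note PQ = Lp_add[OF this near(2) far(2)]
  have iPQ: "integrable lborel (\<lambda>x. (1 / Gamma d) powr \<alpha> * \<bar>P x + Q x\<bar> powr \<alpha>)"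
    using PQ(1) by (simp add: Lp_def)
  have iR: "integrable lborel (\<lambda>x. \<bar>RL_right d g x\<bar> powr \<alpha>)"
    by (rule Bochner_Integration.integrable_bound[OF iPQ]) (use dom in auto)
  then show "RL_right d g \<in> Lp lborel \<alpha>" by (simp add: Lp_def)
  have "(\<integral>x. \<bar>RL_right d g x\<bar> powr \<alpha> \<partial>lborel) \<le> (\<integral>x. (1 / Gamma d) powr \<alpha> * \<bar>P x + Q x\<bar> powr \<alpha> \<partial>lborel)"
    by (rule integral_mono_AE[OF iR iPQ dom])
  also have "\<dots> \<le> (1 / Gamma d) powr \<alpha> * (2 powr \<alpha> *
      ((\<integral>x. \<bar>P x\<bar> powr \<alpha> \<partial>lborel) + (\<integral>x. \<bar>Q x\<bar> powr \<alpha> \<partial>lborel)))"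
    using PQ(2) by (simp add: mult_left_mono)
  also have "\<dots> \<le> (1 / Gamma d) powr \<alpha> * (2 powr \<alpha> * (max ((1 / d) powr \<alpha>) B *
      ((\<integral>x. \<bar>g x\<bar> \<partial>lborel) powr \<alpha> + (\<integral>x. \<bar>g x\<bar> powr \<alpha> \<partial>lborel))))"
  proof (intro mult_left_mono)
    have "(\<integral>x. \<bar>P x\<bar> powr \<alpha> \<partial>lborel) \<le> max ((1 / d) powr \<alpha>) B * (\<integral>x. \<bar>g x\<bar> powr \<alpha> \<partial>lborel)"
      by (rule order_trans[OF near3]) (auto intro!: mult_right_mono integral_nonneg_AE)
    moreover have "(\<integral>x. \<bar>Q x\<bar> powr \<alpha> \<partial>lborel) \<le> max ((1 / d) powr \<alpha>) B * (\<integral>x. \<bar>g x\<bar> \<partial>lborel) powr \<alpha>"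
      by (rule order_trans[OF far3], subst mult.commute) (auto intro!: mult_right_mono)
    ultimately show "(\<integral>x. \<bar>P x\<bar> powr \<alpha> \<partial>lborel) + (\<integral>x. \<bar>Q x\<bar> powr \<alpha> \<partial>lborel)
      \<le> max ((1 / d) powr \<alpha>) B * ((\<integral>x. \<bar>g x\<bar> \<partial>lborel) powr \<alpha> + (\<integral>x. \<bar>g x\<bar> powr \<alpha> \<partial>lborel))"
      by (simp add: distrib_left)
  qed auto
  finally show "(\<integral>x. \<bar>RL_right d g x\<bar> powr \<alpha> \<partial>lborel)
        \<le> C * ((\<integral>x. \<bar>g x\<bar> \<partial>lborel) powr \<alpha> + (\<integral>x. \<bar>g x\<bar> powr \<alpha> \<partial>lborel))"
    by (simp add: C_def mult.assoc)
qed

text \<open>After translation by \<open>x\<close> the indicator is a difference of indicators of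
  intervals starting at 0, with lengths the positive parts of \<open>t - x\<close> and
  \<open>s - x\<close>. Integrating gives a factor \<open>1 / d\<close>, absorbed by
  \<open>Gamma (d + 1) = d * Gamma d\<close>.\<close>

lemma RL_right_indicator:
  assumes d: "0 < d" and st: "s \<le> t"
  shows "set_integrable lborel {x<..} (\<lambda>u. indicator {s<..t} u * (u - x) powr (d - 1))"
    and "RL_right d (indicator {s<..t}) x
      = 1 / Gamma (d + 1) * (max (t - x) 0 powr d - max (s - x) 0 powr d)"
proof -
  let ?k = "\<lambda>c u::real. indicator {0<..max (c - x) 0} u * u powr (d - 1)"
  have k: "has_bochner_integral lborel (?k c) (max (c - x) 0 powr d / d)" for c
    using has_bochner_integral_powr_near_0[of "d - 1" "max (c - x) 0"] d by simp
  have eq: "indicator {x<..} (x + 1 * u) * (indicator {s<..t} (x + 1 * u) * ((x + 1 * u) - x) powr (d - 1)) = ?k t u - ?k s u" for u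
    using st by (auto simp: indicator_def)
  have 1: "has_bochner_integral lborel (\<lambda>u. ?k t u - ?k s u) (max (t - x) 0 powr d / d - max (s - x) 0 powr d / d)"
    by (intro has_bochner_integral_diff k)
  show "set_integrable lborel {x<..} (\<lambda>u. indicator {s<..t} u * (u - x) powr (d - 1))"
    unfolding set_integrable_def real_scaleR_def
    by (subst lborel_integrable_real_affine_iff[symmetric, of 1 _ x], simp, subst eq)
      (use 1 in \<open>auto simp: has_bochner_integral_iff\<close>)
  have "(LINT u:{x<..}|lborel. indicator {s<..t} u * (u - x) powr (d - 1))
      = max (t - x) 0 powr d / d - max (s - x) 0 powr d / d"
    unfolding set_lebesgue_integral_def real_scaleR_def
    by (subst lborel_integral_real_affine[of 1 _ x], simp, subst eq)
      (use 1 in \<open>simp add: has_bochner_integral_iff\<close>)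
  moreover have "Gamma (d + 1) = d * Gamma d"
    using d by (intro Gamma_plus1) (auto elim!: nonpos_Ints_cases)
  moreover have "Gamma d \<noteq> 0" using Gamma_real_pos[OF d] by linarith
  ultimately show "RL_right d (indicator {s<..t}) x
      = 1 / Gamma (d + 1) * (max (t - x) 0 powr d - max (s - x) 0 powr d)"
    using d by (simp add: RL_right_def divide_simps)
qed

text \<open>The integrand of each interval is integrable for every \<open>x\<close>, so linearity
  holds at every point. The two sides are thus equal as functions, and \<open>J\<close> can be
  applied to them directly.\<close>

lemma RL_right_step_fun:
  assumes d: "0 < d" and t: "strict_mono_on {1..n} t"
  shows "RL_right d (step_fun n a t) x
    = (\<Sum>i = 1..<n. a i * RL_right d (indicator {t i<..t (i + 1)}) x)"
proof -
  have le: "t i \<le> t (i + 1)" if "i \<in> {1..<n}" for i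
    using strict_mono_onD[OF t, of i "i + 1"] that by auto
  let ?h = "\<lambda>i u. indicator {t i<..t (i + 1)} u * (u - x) powr (d - 1)"
  have i: "integrable lborel (\<lambda>u. indicator {x<..} u *\<^sub>R ?h i u)" if "i \<in> {1..<n}" for i
    using RL_right_indicator(1)[OF d le[OF that], of x] unfolding set_integrable_def .
  have eq: "indicator {x<..} u *\<^sub>R (step_fun n a t u * (u - x) powr (d - 1))
      = (\<Sum>i = 1..<n. a i * (indicator {x<..} u *\<^sub>R ?h i u))" for u
    unfolding step_fun_def real_scaleR_def sum_distrib_left sum_distrib_right
    by (intro sum.cong refl) (simp only: mult_ac)
  show "RL_right d (step_fun n a t) x
    = (\<Sum>i = 1..<n. a i * RL_right d (indicator {t i<..t (i + 1)}) x)"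
    unfolding RL_right_def set_lebesgue_integral_def eq using i
    by (subst Bochner_Integration.integral_sum) (auto simp: sum_distrib_left intro!: sum.cong)
qed

subsection \<open>Moments of stable distributions\<close>

text \<open>For \<open>y = \<bar>x\<bar>\<close> only the window from \<open>1 / y\<close> to
  \<open>2 / y\<close> is kept. There \<open>\<theta> * y\<close> lies between 1 and 2, within
  \<open>[0, pi]\<close>, so the cosine is at most \<open>cos 1\<close>; the weight is at least its
  value at \<open>2 / y\<close>. Multiplying by the length \<open>1 / y\<close> of the window
  produces \<open>y powr p\<close>.\<close>

lemma powr_le_integral_one_minus_cos:
  fixes x p :: real
  assumes p: "0 < p"
  shows "ennreal ((1 - cos 1) * 2 powr (- 1 - p) * \<bar>x\<bar> powr p)
    \<le> (\<integral>\<^sup>+\<theta>. ennreal (indicator {0<..} \<theta> * \<theta> powr (- 1 - p) * (1 - cos (\<theta> * x))) \<partial>lborel)"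
proof (cases "x = 0")
  case True
  then show ?thesis by simp
next
  case False
  define y where "y = \<bar>x\<bar>"
  have y: "0 < y" using False by (simp add: y_def)
  define c where "c = (1 - cos 1) * (2 / y) powr (- 1 - p)"
  have c0: "0 \<le> c" by (simp add: c_def)
  have "(2 / y) powr (- 1 - p) * (1 / y) = 2 powr (- 1 - p) * y powr p"
    using y by (simp add: powr_divide powr_diff powr_minus divide_simps)
  then have "(1 - cos 1) * 2 powr (- 1 - p) * \<bar>x\<bar> powr p = c * (1 / y)"
    by (simp only: c_def y_def mult.assoc)
  then have "ennreal ((1 - cos 1) * 2 powr (- 1 - p) * \<bar>x\<bar> powr p) = ennreal c * ennreal (1 / y)"
    using y c0 by (simp only: ennreal_mult less_imp_le zero_less_divide_1_iff)
  also have "\<dots> = (\<integral>\<^sup>+\<theta>. ennreal c * indicator {1 / y..2 / y} \<theta> \<partial>lborel)"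
    using y by (simp add: nn_integral_cmult divide_right_mono flip: diff_divide_distrib)
  also have "\<dots> \<le> (\<integral>\<^sup>+\<theta>. ennreal (indicator {0<..} \<theta> * \<theta> powr (- 1 - p) * (1 - cos (\<theta> * x))) \<partial>lborel)"
  proof (rule nn_integral_mono)
    fix \<theta> :: real
    show "ennreal c * indicator {1 / y..2 / y} \<theta>
      \<le> ennreal (indicator {0<..} \<theta> * \<theta> powr (- 1 - p) * (1 - cos (\<theta> * x)))"
    proof (cases "\<theta> \<in> {1 / y..2 / y}")
      case True
      then have \<theta>: "1 \<le> \<theta> * y" "\<theta> * y \<le> 2" "\<theta> \<le> 2 / y"
        using y by (auto simp: field_simps)
      have \<theta>0: "0 < \<theta>" using True y by (meson atLeastAtMost_iff less_le_trans zero_less_divide_1_iff)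
      have "cos (\<theta> * x) = cos (\<theta> * y)"
        by (auto simp: y_def abs_if)
      also have "\<dots> \<le> cos 1"
        using \<theta> pi_ge_two by (intro cos_monotone_0_pi_le) auto
      finally have "1 - cos 1 \<le> 1 - cos (\<theta> * x)" by simp
      moreover have "(2 / y) powr (- 1 - p) \<le> \<theta> powr (- 1 - p)"
        using p y \<theta> \<theta>0 by (intro powr_mono2') auto
      ultimately have "c \<le> \<theta> powr (- 1 - p) * (1 - cos (\<theta> * x))"
        unfolding c_def by (subst mult.commute, intro mult_mono) auto
      then show ?thesis using True \<theta>0 by (simp add: ennreal_leI)
    qed simp
  qed
  finally show ?thesis .
qed

text \<open>Integrating the preceding bound over \<open>N\<close> and exchanging integrals leaves
  \<open>1 - exp (- (\<bar>\<theta>\<bar> powr \<alpha> * s))\<close> against the weight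
  \<open>\<theta> powr (- 1 - p)\<close>. The assumption \<open>p < \<alpha>\<close> gives
  convergence at 0 and \<open>0 < p\<close> gives it at infinity.\<close>

lemma stable_absolute_moment_integrable:
  fixes N :: "real measure"
  assumes N: "real_distribution N" and p: "0 < p" "p < \<alpha>" and s: "0 \<le> s"
    and char: "\<And>\<theta>. char N \<theta> = complex_of_real (exp (- (\<bar>\<theta>\<bar> powr \<alpha> * s)))"
  shows "integrable N (\<lambda>x. \<bar>x\<bar> powr p)"
proof -
  interpret N: real_distribution N by (rule N)
  interpret pair_sigma_finite N lborel ..
  define w where "w = (\<lambda>\<theta>::real. indicator {0<..} \<theta> * \<theta> powr (- 1 - p))"
  have [measurable]: "w \<in> borel_measurable borel" unfolding w_def by measurable
  have w0: "0 \<le> w \<theta>" for \<theta> by (simp add: w_def)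
  define c where "c = (1 - cos 1) * 2 powr (- 1 - p)"
  have "cos (1::real) < cos 0" by (rule cos_monotone_0_pi) (use pi_ge_two in auto)
  then have c0: "0 < c" by (simp add: c_def)
  have cosint: "integrable N (\<lambda>x. cos (\<theta> * x))" for \<theta>
    by (rule N.integrable_const_bound[of _ 1]) auto
  have cos: "(\<integral>x. cos (\<theta> * x) \<partial>N) = exp (- (\<bar>\<theta>\<bar> powr \<alpha> * s))" for \<theta>
  proof -
    have "integrable N (\<lambda>x. iexp (\<theta> * x))" by (rule N.integrable_iexp) auto
    then have "Re (char N \<theta>) = (\<integral>x. Re (iexp (\<theta> * x)) \<partial>N)"
      unfolding char_def by (rule integral_Re[symmetric])
    then show ?thesis by (simp add: char Re_exp)
  qed
  \<comment> \<open>The majorant uses \<open>1 - exp (- z) \<le> z\<close> up to \<theta> = 1 and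
    \<open>1 - exp (- z) \<le> 1\<close> beyond.\<close>
  define D where "D = (\<lambda>\<theta>. s * (indicator {0<..1} \<theta> * \<theta> powr (\<alpha> - 1 - p)) + indicator {1<..} \<theta> * \<theta> powr (- 1 - p))"
  have D: "integrable lborel D"
    unfolding D_def
    using has_bochner_integral_powr_near_0[of "\<alpha> - 1 - p" 1] integrable_powr_at_infinity[of "- 1 - p"] p
    by (auto simp: has_bochner_integral_iff)
  have D0: "0 \<le> D \<theta>" for \<theta>
    using s by (simp add: D_def)
  have inner: "(\<integral>\<^sup>+x. ennreal (w \<theta> * (1 - cos (\<theta> * x))) \<partial>N) \<le> ennreal (D \<theta>)" for \<theta>
  proof -
    have "(\<integral>\<^sup>+x. ennreal (w \<theta> * (1 - cos (\<theta> * x))) \<partial>N) = ennreal (\<integral>x. w \<theta> * (1 - cos (\<theta> * x)) \<partial>N)"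
      using cosint w0 by (intro nn_integral_eq_integral) auto
    also have "(\<integral>x. w \<theta> * (1 - cos (\<theta> * x)) \<partial>N) = w \<theta> * (1 - exp (- (\<bar>\<theta>\<bar> powr \<alpha> * s)))"
      using cosint N.prob_space by (simp add: cos)
    also have "\<dots> \<le> D \<theta>"
    proof -
      consider "\<theta> \<le> 0" | "0 < \<theta>" "\<theta> \<le> 1" | "1 < \<theta>" by linarith
      then show ?thesis
      proof cases
        case 2
        have "1 - exp (- (\<bar>\<theta>\<bar> powr \<alpha> * s)) \<le> \<theta> powr \<alpha> * s"
          using exp_ge_add_one_self[of "- (\<bar>\<theta>\<bar> powr \<alpha> * s)"] 2 by simp
        then have "\<theta> powr (- 1 - p) * (1 - exp (- (\<bar>\<theta>\<bar> powr \<alpha> * s))) \<le> \<theta> powr (- 1 - p) * (\<theta> powr \<alpha> * s)"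
          by (intro mult_left_mono) auto
        also have "\<dots> = s * \<theta> powr (\<alpha> - 1 - p)"
          by (simp add: powr_add[symmetric] mult_ac algebra_simps)
        finally show ?thesis using 2 by (simp add: w_def D_def)
      next
        case 3
        have "\<theta> powr (- 1 - p) * (1 - exp (- (\<bar>\<theta>\<bar> powr \<alpha> * s))) \<le> \<theta> powr (- 1 - p) * 1"
          by (intro mult_left_mono) auto
        then show ?thesis using 3 by (simp add: w_def D_def)
      qed (simp add: w_def D_def)
    qed
    finally show ?thesis by (simp add: ennreal_leI)
  qed
  have "(\<integral>\<^sup>+x. ennreal (c * \<bar>x\<bar> powr p) \<partial>N)
      \<le> (\<integral>\<^sup>+x. (\<integral>\<^sup>+\<theta>. ennreal (w \<theta> * (1 - cos (\<theta> * x))) \<partial>lborel) \<partial>N)"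
    unfolding c_def w_def by (intro nn_integral_mono powr_le_integral_one_minus_cos p)
  also have "\<dots> = (\<integral>\<^sup>+\<theta>. (\<integral>\<^sup>+x. ennreal (w \<theta> * (1 - cos (\<theta> * x))) \<partial>N) \<partial>lborel)"
    by (rule Fubini'[symmetric]) simp
  also have "\<dots> \<le> (\<integral>\<^sup>+\<theta>. ennreal (D \<theta>) \<partial>lborel)"
    by (intro nn_integral_mono inner)
  also have "\<dots> < \<infinity>"
    using D D0 by (subst nn_integral_eq_integral) auto
  finally have "integrable N (\<lambda>x. c * \<bar>x\<bar> powr p)"
    using c0 by (intro integrableI_nonneg) auto
  then show ?thesis using c0 by simp
qed

text \<open>\<open>Y\<close> and \<open>c * X\<close> with \<open>c = s powr (1 / \<alpha>)\<close>
  have the same characteristic function, hence the same law, and moments scale by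
  \<open>c powr p\<close>. The degenerate case \<open>s = 0\<close> is included, with
  \<open>c = 0\<close>.\<close>

lemma (in prob_space) stable_absolute_moment:
  assumes X[measurable]: "X \<in> borel_measurable M" and Y[measurable]: "Y \<in> borel_measurable M"
    and p: "0 < p" "p < \<alpha>" and s: "0 \<le> s"
    and cX: "\<And>\<theta>. char (distr M borel X) \<theta> = complex_of_real (exp (- (\<bar>\<theta>\<bar> powr \<alpha>)))"
    and cY: "\<And>\<theta>. char (distr M borel Y) \<theta> = complex_of_real (exp (- (\<bar>\<theta>\<bar> powr \<alpha> * s)))"
  shows "Y \<in> Lp M p"
    and "(\<integral>\<omega>. \<bar>Y \<omega>\<bar> powr p \<partial>M) = s powr (p / \<alpha>) * (\<integral>\<omega>. \<bar>X \<omega>\<bar> powr p \<partial>M)"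
proof -
  define c where "c = s powr (1 / \<alpha>)"
  have c: "c powr \<alpha> = s" "0 \<le> c" using p s by (auto simp: c_def powr_powr)
  have "char (distr M borel (\<lambda>\<omega>. c * X \<omega>)) = char (distr M borel Y)"
  proof
    fix \<theta>
    have "char (distr M borel (\<lambda>\<omega>. c * X \<omega>)) \<theta> = char (distr M borel X) (\<theta> * c)"
      by (simp add: char_def integral_distr mult.assoc)
    then show "char (distr M borel (\<lambda>\<omega>. c * X \<omega>)) \<theta> = char (distr M borel Y) \<theta>"
      using c by (simp add: cX cY abs_mult powr_mult)
  qed
  then have eq: "distr M borel (\<lambda>\<omega>. c * X \<omega>) = distr M borel Y"
    by (intro Levy_uniqueness real_distribution_distr) auto
  have "integrable (distr M borel Y) (\<lambda>x. \<bar>x\<bar> powr p)"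
    by (rule stable_absolute_moment_integrable[OF real_distribution_distr p s cY]) simp
  then show "Y \<in> Lp M p" by (simp add: Lp_def integrable_distr_eq)
  have "(\<integral>\<omega>. \<bar>Y \<omega>\<bar> powr p \<partial>M) = (\<integral>x. \<bar>x\<bar> powr p \<partial>distr M borel Y)"
    by (simp add: integral_distr)
  also have "\<dots> = (\<integral>\<omega>. \<bar>c * X \<omega>\<bar> powr p \<partial>M)"
    by (simp add: integral_distr flip: eq)
  also have "\<dots> = s powr (p / \<alpha>) * (\<integral>\<omega>. \<bar>X \<omega>\<bar> powr p \<partial>M)"
    using c by (simp add: abs_mult powr_mult) (simp add: c_def powr_powr)
  finally show "(\<integral>\<omega>. \<bar>Y \<omega>\<bar> powr p \<partial>M) = s powr (p / \<alpha>) * (\<integral>\<omega>. \<bar>X \<omega>\<bar> powr p \<partial>M)" .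
qed

subsection \<open>Density of step functions\<close>

text \<open>The value of a function with this property can only change immediately to the right of a
  point of \<open>T\<close>; the description avoids common refinements of partitions.\<close>

definition step_like :: "(real \<Rightarrow> real) \<Rightarrow> bool" where
  "step_like \<phi> \<longleftrightarrow> (\<exists>T B. finite T \<and> (\<forall>x. B \<le> \<bar>x\<bar> \<longrightarrow> \<phi> x = 0) \<and>
     (\<forall>x y. x < y \<longrightarrow> T \<inter> {x..<y} = {} \<longrightarrow> \<phi> x = \<phi> y))"

lemma step_like_zero: "step_like (\<lambda>x. 0)"
  unfolding step_like_def by blast

lemma step_like_scale: "step_like \<phi> \<Longrightarrow> step_like (\<lambda>x. c * \<phi> x)"
  unfolding step_like_def by (metis mult_zero_right)

lemma step_like_add:
  assumes "step_like \<phi>" "step_like \<psi>"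
  shows "step_like (\<lambda>x. \<phi> x + \<psi> x)"
proof -
  obtain T B where 1: "finite T" "\<And>x. B \<le> \<bar>x\<bar> \<Longrightarrow> \<phi> x = 0"
    "\<And>x y. x < y \<Longrightarrow> T \<inter> {x..<y} = {} \<Longrightarrow> \<phi> x = \<phi> y"
    using assms(1) unfolding step_like_def by auto
  obtain T' B' where 2: "finite T'" "\<And>x. B' \<le> \<bar>x\<bar> \<Longrightarrow> \<psi> x = 0"
    "\<And>x y. x < y \<Longrightarrow> T' \<inter> {x..<y} = {} \<Longrightarrow> \<psi> x = \<psi> y"
    using assms(2) unfolding step_like_def by auto
  show ?thesis
    unfolding step_like_def
  proof (intro exI conjI allI impI)
    show "finite (T \<union> T')" using 1 2 by simp
    show "\<phi> x + \<psi> x = 0" if "max B B' \<le> \<bar>x\<bar>" for x using 1(2) 2(2) that by simp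
    show "\<phi> x + \<psi> x = \<phi> y + \<psi> y" if "x < y" "(T \<union> T') \<inter> {x..<y} = {}" for x y
      using 1(3)[OF that(1)] 2(3)[OF that(1)] that(2) by (simp add: Int_Un_distrib2)
  qed
qed

lemma step_like_indicator: "step_like (indicator {s<..t})"
  unfolding step_like_def
proof (intro exI conjI allI impI)
  show "finite {s, t}" by simp
  show "indicator {s<..t} x = 0" if "\<bar>s\<bar> + \<bar>t\<bar> + 1 \<le> \<bar>x\<bar>" for x
    using that by (auto simp: indicator_def)
  show "indicator {s<..t} x = indicator {s<..t} y" if "x < y" "{s, t} \<inter> {x..<y} = {}" for x y
    using that by (auto simp: indicator_def)
qed

text \<open>The possible jump points, together with two points bounding the support, are sorted into
  nodes. On each interval, open on the left and closed on the right, the function equals its value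
  at the right endpoint.\<close>

lemma step_like_step_fun:
  assumes "step_like \<phi>"
  obtains n a t where "2 \<le> n" "strict_mono_on {1..n} t" "\<phi> = step_fun n a t"
proof -
  obtain T0 B0 where 1: "finite T0" "\<And>x. B0 \<le> \<bar>x\<bar> \<Longrightarrow> \<phi> x = 0"
    "\<And>x y. x < y \<Longrightarrow> T0 \<inter> {x..<y} = {} \<Longrightarrow> \<phi> x = \<phi> y"
    using assms unfolding step_like_def by auto
  \<comment> \<open>The lower bound 1 keeps \<open>- B\<close> and \<open>B\<close> distinct, which
    guarantees two nodes.\<close>
  define B where "B = max B0 1"
  define T where "T = insert (- B) (insert B T0)"
  define ys where "ys = sorted_list_of_set T"
  define n where "n = length ys"
  \<comment> \<open>List positions start at 0, nodes at 1.\<close>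
  define t where "t = (\<lambda>i. ys ! (i - 1))"
  define a where "a = (\<lambda>i. \<phi> (t (i + 1)))"
  have fT: "finite T" using 1 by (simp add: T_def)
  have sorted: "sorted_wrt (<) ys" by (simp add: ys_def)
  have set: "set ys = T" using fT by (simp add: ys_def)
  have n: "n = card T" using fT by (simp add: n_def ys_def)
  have "card {- B, B} \<le> card T" by (rule card_mono[OF fT]) (auto simp: T_def)
  then have n2: "2 \<le> n" using n by (auto simp: B_def card_insert_if)
  have mono: "strict_mono_on {1..n} t"
    by (rule strict_mono_onI) (auto simp: t_def n_def intro!: sorted_wrt_nth_less[OF sorted])
  have T: "\<exists>i\<in>{1..n}. t i = u" if "u \<in> T" for u
  proof -
    have "u \<in> set ys" using that set by simp
    then obtain k where "k < n" "ys ! k = u" unfolding in_set_conv_nth n_def by blast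
    then have "Suc k \<in> {1..n}" "t (Suc k) = u" by (auto simp: t_def)
    then show ?thesis by blast
  qed
  have less: "t i < t j \<longleftrightarrow> i < j" if "i \<in> {1..n}" "j \<in> {1..n}" for i j
    using strict_mono_on_less[OF mono that] .
  have le: "t i \<le> t j \<longleftrightarrow> i \<le> j" if "i \<in> {1..n}" "j \<in> {1..n}" for i j
    using less[OF that(2,1)] by auto
  obtain iB where iB: "iB \<in> {1..n}" "t iB = B" using T[of B] by (auto simp: T_def)
  obtain iC where iC: "iC \<in> {1..n}" "t iC = - B" using T[of "- B"] by (auto simp: T_def)
  have "\<phi> x = step_fun n a t x" for x
  proof (cases "t 1 < x \<and> x \<le> t n")
    case False
    have "\<phi> x = 0"
    proof (rule 1(2))
      have "t 1 \<le> - B" using le[of 1 iC] iC n2 by auto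
      moreover have "B \<le> t n" using le[of iB n] iB n2 by auto
      ultimately show "B0 \<le> \<bar>x\<bar>" using False by (auto simp: B_def)
    qed
    moreover have "step_fun n a t x = 0"
      unfolding step_fun_def
    proof (intro sum.neutral ballI)
      fix i assume i: "i \<in> {1..<n}"
      have "t 1 \<le> t i" "t (i + 1) \<le> t n" using i le[of 1 i] le[of "i + 1" n] by auto
      then show "a i * indicator {t i<..t (i + 1)} x = 0" using False by (auto simp: indicator_def)
    qed
    ultimately show ?thesis by simp
  next
    case True
    \<comment> \<open>The first node not to the left of \<open>x\<close>: \<open>x\<close> lies in
      the interval that ends at \<open>t j\<close>, which has index \<open>j - 1\<close>.\<close>
    define j where "j = (LEAST j. j \<in> {1..n} \<and> x \<le> t j)"
    have j: "j \<in> {1..n} \<and> x \<le> t j"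
      unfolding j_def by (rule LeastI[of _ n]) (use True n2 in auto)
    have least: "j \<le> k" if "k \<in> {1..n}" "x \<le> t k" for k
      unfolding j_def by (rule Least_le) (use that in auto)
    have j1: "1 < j" using j True by (metis atLeastAtMost_iff le_neq_implies_less not_le)
    have "a k * indicator {t k<..t (k + 1)} x = (if k = j - 1 then \<phi> (t j) else 0)" if k: "k \<in> {1..<n}" for k
    proof (cases "t k < x \<and> x \<le> t (k + 1)")
      case True
      have "t k < t j" using True j by linarith
      then have "k < j" using less[of k j] k j by auto
      moreover have "j \<le> k + 1" using least[of "k + 1"] k True by auto
      ultimately have "k = j - 1" by simp
      then show ?thesis using True j1 by (simp add: a_def)
    next
      case False
      have "k \<noteq> j - 1"
      proof
        assume kj: "k = j - 1"
        then have "t k < x" using least[of k] k j1 by force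
        then show False using False j j1 kj by simp
      qed
      then show ?thesis using False by (auto simp: indicator_def)
    qed
    then have "step_fun n a t x = (\<Sum>k = 1..<n. if k = j - 1 then \<phi> (t j) else 0)"
      unfolding step_fun_def by (intro sum.cong) auto
    also have "\<dots> = \<phi> (t j)" using j j1 by auto
    also have "\<phi> (t j) = \<phi> x"
    proof (cases "x = t j")
      case False
      \<comment> \<open>A jump point here would be a node before \<open>t j\<close> and not to the
        left of \<open>x\<close>, against minimality of \<open>j\<close>.\<close>
      have "T0 \<inter> {x..<t j} = {}"
      proof (rule ccontr)
        assume "T0 \<inter> {x..<t j} \<noteq> {}"
        then obtain u where "u \<in> T0" "x \<le> u" "u < t j" by auto
        then have u: "u \<in> T" "x \<le> u" "u < t j" by (auto simp: T_def)
        obtain k where k: "k \<in> {1..n}" "t k = u" using T[OF u(1)] by auto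
        then have "j \<le> k" using least u by auto
        then show False using le[of j k] j k u by auto
      qed
      then show ?thesis using 1(3)[of x "t j"] j False by auto
    qed simp
    finally show ?thesis by simp
  qed
  then show ?thesis using that n2 mono by blast
qed

lemma indicator_Lp:
  assumes "0 < p" "integrable M (indicator A :: _ \<Rightarrow> real)"
  shows "indicator A \<in> Lp M p"
proof -
  have "(\<lambda>x. \<bar>indicator A x :: real\<bar> powr p) = indicator A"
    using assms(1) by (auto simp: indicator_def)
  then show ?thesis using assms(2) by (simp add: Lp_def)
qed

lemma step_fun_Lp:
  assumes "0 < p"
  shows "step_fun n a t \<in> Lp lborel p"
proof -
  have "indicator {t i<..t (i + 1)} \<in> Lp lborel p" for i
    by (intro indicator_Lp[OF assms] integrable_real_indicator emeasure_bounded_finite bounded_Ioc) simp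
  then have "(\<lambda>x. \<Sum>i = 1..<n. a i * indicator {t i<..t (i + 1)} x) \<in> Lp lborel p"
    using assms by (intro Lp_sum) auto
  then show ?thesis by (simp add: step_fun_def[abs_def])
qed

lemma step_like_Lp: "step_like \<phi> \<Longrightarrow> 0 < p \<Longrightarrow> \<phi> \<in> Lp lborel p"
  by (metis step_like_step_fun step_fun_Lp)

text \<open>A single \<phi> must be close to \<open>h\<close> for all exponents in \<open>P\<close>
  at once. Separate approximations for the exponents 1 and \<alpha> would not control
  \<open>RL_right\<close>, whose bound involves both norms of the same function.\<close>

definition step_approximable :: "real set \<Rightarrow> (real \<Rightarrow> real) \<Rightarrow> bool" where
  "step_approximable P h \<longleftrightarrow> (\<forall>p\<in>P. h \<in> Lp lborel p) \<and>
     (\<forall>\<epsilon>>0. \<exists>\<phi>. step_like \<phi> \<and> (\<forall>p\<in>P. (\<integral>x. \<bar>\<phi> x - h x\<bar> powr p \<partial>lborel) < \<epsilon>))"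

text \<open>A common bound for the constants lets one tolerance serve all exponents; the summand 1
  keeps it positive, so that it can be divided by.\<close>

lemma finite_powr_bound:
  fixes c :: real
  assumes "finite P"
  obtains K where "0 < K" "\<And>p. p \<in> P \<Longrightarrow> c powr p \<le> K"
proof
  show "0 < 1 + (\<Sum>p\<in>P. c powr p)"
    by (intro add_pos_nonneg sum_nonneg) auto
  show "c powr p \<le> 1 + (\<Sum>p\<in>P. c powr p)" if "p \<in> P" for p
    using member_le_sum[of p P "\<lambda>p. c powr p"] that assms by simp
qed

section \<open>Simultaneous approximation for finitely many exponents\<close>

context
  fixes P :: "real set"
  assumes finP: "finite P" and posP: "\<And>p. p \<in> P \<Longrightarrow> 0 < p"
begin

lemma step_approximable_step_like: "step_like \<phi> \<Longrightarrow> step_approximable P \<phi>"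
  unfolding step_approximable_def using step_like_Lp posP by (auto intro!: exI[of _ \<phi>])

lemma step_approximable_add:
  assumes f: "step_approximable P f" and g: "step_approximable P g"
  shows "step_approximable P (\<lambda>x. f x + g x)"
  unfolding step_approximable_def
proof (intro conjI ballI allI impI)
  show "(\<lambda>x. f x + g x) \<in> Lp lborel p" if "p \<in> P" for p
    using f g that posP by (intro Lp_add) (auto simp: step_approximable_def less_imp_le)
  fix \<epsilon> :: real assume \<epsilon>: "0 < \<epsilon>"
  obtain K where K0: "0 < K" and K: "\<And>p. p \<in> P \<Longrightarrow> 2 powr p \<le> K"
    using finite_powr_bound[OF finP] by blast
  have \<delta>: "0 < \<epsilon> / (2 * K)" using \<epsilon> K0 by simp
  obtain \<phi> \<psi> where \<phi>: "step_like \<phi>" "\<And>p. p \<in> P \<Longrightarrow> (\<integral>x. \<bar>\<phi> x - f x\<bar> powr p \<partial>lborel) < \<epsilon> / (2 * K)"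
    and \<psi>: "step_like \<psi>" "\<And>p. p \<in> P \<Longrightarrow> (\<integral>x. \<bar>\<psi> x - g x\<bar> powr p \<partial>lborel) < \<epsilon> / (2 * K)"
    using f g \<delta> unfolding step_approximable_def by meson
  show "\<exists>\<phi>. step_like \<phi> \<and> (\<forall>p\<in>P. (\<integral>x. \<bar>\<phi> x - (f x + g x)\<bar> powr p \<partial>lborel) < \<epsilon>)"
  proof (intro exI conjI ballI)
    show "step_like (\<lambda>x. \<phi> x + \<psi> x)" by (intro step_like_add \<phi> \<psi>)
    fix p assume p: "p \<in> P"
    have p0: "0 \<le> p" using posP[OF p] by simp
    have d1: "(\<lambda>x. \<phi> x - f x) \<in> Lp lborel p" and d2: "(\<lambda>x. \<psi> x - g x) \<in> Lp lborel p"
      using step_like_Lp[OF \<phi>(1) posP[OF p]] step_like_Lp[OF \<psi>(1) posP[OF p]] f g p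
      by (auto intro!: Lp_diff p0 simp: step_approximable_def)
    have "(\<integral>x. \<bar>\<phi> x + \<psi> x - (f x + g x)\<bar> powr p \<partial>lborel)
      = (\<integral>x. \<bar>(\<phi> x - f x) + (\<psi> x - g x)\<bar> powr p \<partial>lborel)"
      by (simp add: algebra_simps)
    also have "\<dots> \<le> 2 powr p * ((\<integral>x. \<bar>\<phi> x - f x\<bar> powr p \<partial>lborel) + (\<integral>x. \<bar>\<psi> x - g x\<bar> powr p \<partial>lborel))"
      by (rule Lp_add(2)[OF p0 d1 d2])
    also have "\<dots> < 2 powr p * (\<epsilon> / (2 * K) + \<epsilon> / (2 * K))"
      by (intro mult_strict_left_mono add_strict_mono \<phi> \<psi> p) simp
    also have "\<dots> \<le> K * (\<epsilon> / (2 * K) + \<epsilon> / (2 * K))"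
      by (intro mult_right_mono K p) (use \<epsilon> K0 in auto)
    also have "\<dots> = \<epsilon>" using K0 by simp
    finally show "(\<integral>x. \<bar>\<phi> x + \<psi> x - (f x + g x)\<bar> powr p \<partial>lborel) < \<epsilon>" .
  qed
qed

lemma step_approximable_scale:
  assumes f: "step_approximable P f"
  shows "step_approximable P (\<lambda>x. c * f x)"
  unfolding step_approximable_def
proof (intro conjI ballI allI impI)
  show "(\<lambda>x. c * f x) \<in> Lp lborel p" if "p \<in> P" for p
    using f that by (intro Lp_scale) (auto simp: step_approximable_def)
  fix \<epsilon> :: real assume \<epsilon>: "0 < \<epsilon>"
  obtain K where K0: "0 < K" and K: "\<And>p. p \<in> P \<Longrightarrow> \<bar>c\<bar> powr p \<le> K"
    using finite_powr_bound[OF finP] by blast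
  have \<delta>: "0 < \<epsilon> / (2 * K)" using \<epsilon> K0 by simp
  obtain \<phi> where \<phi>: "step_like \<phi>" "\<And>p. p \<in> P \<Longrightarrow> (\<integral>x. \<bar>\<phi> x - f x\<bar> powr p \<partial>lborel) < \<epsilon> / (2 * K)"
    using f \<delta> unfolding step_approximable_def by meson
  show "\<exists>\<phi>. step_like \<phi> \<and> (\<forall>p\<in>P. (\<integral>x. \<bar>\<phi> x - c * f x\<bar> powr p \<partial>lborel) < \<epsilon>)"
  proof (intro exI conjI ballI)
    show "step_like (\<lambda>x. c * \<phi> x)" by (intro step_like_scale \<phi>)
    fix p assume p: "p \<in> P"
    have "(\<integral>x. \<bar>c * \<phi> x - c * f x\<bar> powr p \<partial>lborel) = \<bar>c\<bar> powr p * (\<integral>x. \<bar>\<phi> x - f x\<bar> powr p \<partial>lborel)"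
      by (simp add: abs_mult powr_mult flip: right_diff_distrib)
    also have "\<dots> \<le> K * (\<epsilon> / (2 * K))"
      by (intro mult_mono K p less_imp_le[OF \<phi>(2)]) (use K0 in \<open>auto intro!: integral_nonneg_AE\<close>)
    also have "\<dots> < \<epsilon>" using K0 \<epsilon> by simp
    finally show "(\<integral>x. \<bar>c * \<phi> x - c * f x\<bar> powr p \<partial>lborel) < \<epsilon>" .
  qed
qed

lemma step_approximable_sum:
  assumes "\<And>i. i \<in> I \<Longrightarrow> step_approximable P (f i)"
  shows "step_approximable P (\<lambda>x. \<Sum>i\<in>I. f i x)"
  using assms
  by (induction I rule: infinite_finite_induct)
    (auto intro: step_approximable_step_like step_like_zero step_approximable_add)

text \<open>Dominated convergence, with majorant the \<open>p\<close>-th power of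
  \<open>2 * w\<close>, applies for each exponent. As \<open>P\<close> is finite, one index
  \<open>i\<close> is good for all of them, and \<open>s i\<close> is then replaced by a step
  function.\<close>

lemma step_approximable_limit:
  assumes s: "\<And>i :: nat. step_approximable P (s i)"
    and lim: "\<And>x. (\<lambda>i. s i x) \<longlonglongrightarrow> f x"
    and bound: "\<And>i x. \<bar>s i x\<bar> \<le> w x" and w: "\<And>p. p \<in> P \<Longrightarrow> w \<in> Lp lborel p"
    and fm: "f \<in> borel_measurable borel"
  shows "step_approximable P f"
proof -
  have fw: "\<bar>f x\<bar> \<le> w x" for x
    by (rule LIMSEQ_le_const2[OF tendsto_rabs[OF lim]]) (use bound in auto)
  have w0: "0 \<le> w x" for x using fw[of x] by linarith
  have fLp: "f \<in> Lp lborel p" if p: "p \<in> P" for p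
  proof -
    have "integrable lborel (\<lambda>x. \<bar>f x\<bar> powr p)"
      by (rule Bochner_Integration.integrable_bound[OF Lp_integrable[OF w[OF p]]])
        (use fm fw w0 posP[OF p] in \<open>auto intro!: AE_I2 powr_mono2\<close>)
    then show ?thesis using fm by (simp add: Lp_def)
  qed
  have conv: "(\<lambda>i. \<integral>x. \<bar>s i x - f x\<bar> powr p \<partial>lborel) \<longlonglongrightarrow> 0" if p: "p \<in> P" for p
  proof -
    have [measurable]: "f \<in> borel_measurable borel" by (rule fm)
    have [measurable]: "s i \<in> borel_measurable borel" for i
      using s[of i] p by (auto simp: step_approximable_def Lp_def)
    have "(\<lambda>i. \<integral>x. \<bar>s i x - f x\<bar> powr p \<partial>lborel) \<longlonglongrightarrow> (\<integral>x. 0 \<partial>(lborel :: real measure))"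
    proof (rule integral_dominated_convergence)
      show "integrable lborel (\<lambda>x. \<bar>2 * w x\<bar> powr p)"
        using Lp_scale[OF w[OF p], of 2] by (rule Lp_integrable)
      show "AE x in lborel. (\<lambda>i. \<bar>s i x - f x\<bar> powr p) \<longlonglongrightarrow> 0"
      proof (rule AE_I2)
        fix x
        have "(\<lambda>i. \<bar>s i x - f x\<bar>) \<longlonglongrightarrow> 0"
          using lim[of x] by (simp add: LIM_zero_iff tendsto_rabs_zero_iff)
        then show "(\<lambda>i. \<bar>s i x - f x\<bar> powr p) \<longlonglongrightarrow> 0"
          using tendsto_powr'[of "\<lambda>i. \<bar>s i x - f x\<bar>" 0 sequentially "\<lambda>_. p" p] posP[OF p] by simp
      qed
      show "AE x in lborel. norm (\<bar>s i x - f x\<bar> powr p) \<le> \<bar>2 * w x\<bar> powr p" for i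
      proof (rule AE_I2)
        fix x
        have "\<bar>s i x - f x\<bar> \<le> \<bar>2 * w x\<bar>" using bound[of i x] fw[of x] by linarith
        then show "norm (\<bar>s i x - f x\<bar> powr p) \<le> \<bar>2 * w x\<bar> powr p"
          using posP[OF p] by (simp add: powr_mono2)
      qed
    qed auto
    then show ?thesis by simp
  qed
  show ?thesis
    unfolding step_approximable_def
  proof (intro conjI ballI allI impI fLp)
    fix \<epsilon> :: real assume \<epsilon>: "0 < \<epsilon>"
    obtain K where K0: "0 < K" and K: "\<And>p. p \<in> P \<Longrightarrow> 2 powr p \<le> K"
      using finite_powr_bound[OF finP] by blast
    have \<delta>: "0 < \<epsilon> / (2 * K)" using \<epsilon> K0 by simp
    have "\<forall>\<^sub>F i in sequentially. \<forall>p\<in>P. (\<integral>x. \<bar>s i x - f x\<bar> powr p \<partial>lborel) < \<epsilon> / (2 * K)"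
      by (intro eventually_ball_finite finP ballI order_tendstoD(2)[OF conv \<delta>])
    then obtain i where i: "\<And>p. p \<in> P \<Longrightarrow> (\<integral>x. \<bar>s i x - f x\<bar> powr p \<partial>lborel) < \<epsilon> / (2 * K)"
      using eventually_happens'[OF sequentially_bot] by blast
    obtain \<phi> where \<phi>: "step_like \<phi>" "\<And>p. p \<in> P \<Longrightarrow> (\<integral>x. \<bar>\<phi> x - s i x\<bar> powr p \<partial>lborel) < \<epsilon> / (2 * K)"
      using s[of i] \<delta> unfolding step_approximable_def by meson
    show "\<exists>\<phi>. step_like \<phi> \<and> (\<forall>p\<in>P. (\<integral>x. \<bar>\<phi> x - f x\<bar> powr p \<partial>lborel) < \<epsilon>)"
    proof (intro exI conjI ballI)
      show "step_like \<phi>" by fact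
      fix p assume p: "p \<in> P"
      have p0: "0 \<le> p" using posP[OF p] by simp
      have si: "s i \<in> Lp lborel p" using s p by (auto simp: step_approximable_def)
      have "(\<integral>x. \<bar>\<phi> x - f x\<bar> powr p \<partial>lborel) = (\<integral>x. \<bar>(\<phi> x - s i x) + (s i x - f x)\<bar> powr p \<partial>lborel)"
        by simp
      also have "\<dots> \<le> 2 powr p * ((\<integral>x. \<bar>\<phi> x - s i x\<bar> powr p \<partial>lborel) + (\<integral>x. \<bar>s i x - f x\<bar> powr p \<partial>lborel))"
        by (intro Lp_add(2) Lp_diff p0 si fLp[OF p] step_like_Lp[OF \<phi>(1) posP[OF p]])
      also have "\<dots> < 2 powr p * (\<epsilon> / (2 * K) + \<epsilon> / (2 * K))"
        by (intro mult_strict_left_mono add_strict_mono \<phi> i p) simp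
      also have "\<dots> \<le> K * (\<epsilon> / (2 * K) + \<epsilon> / (2 * K))"
        by (intro mult_right_mono K p) (use \<epsilon> K0 in auto)
      also have "\<dots> = \<epsilon>" using K0 by simp
      finally show "(\<integral>x. \<bar>\<phi> x - f x\<bar> powr p \<partial>lborel) < \<epsilon>" .
    qed
  qed
qed

text \<open>A Dynkin class argument starting from the half-open intervals, which are stable under
  intersection and generate the Borel sets. Cutting with \<open>{u<..v}\<close> keeps complements of
  finite measure and supplies a majorant for countable unions.\<close>

lemma step_approximable_bounded_indicator:
  assumes A: "A \<in> sets borel"
  shows "step_approximable P (indicator (A \<inter> {u<..v}))"
proof -
  let ?G = "range (\<lambda>(a, b). {a<..b::real})"
  have int: "Int_stable ?G"
    by (auto simp: Int_stable_def intro!: image_eqI[where x = "(max _ _, min _ _)"])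
  have sub: "?G \<subseteq> Pow UNIV" by simp
  have borel: "sets borel = sigma_sets UNIV ?G"
    by (subst borel_sigma_sets_Ioc) (simp add: sets_measure_of)
  have w: "indicator {u<..v} \<in> Lp lborel p" if "p \<in> P" for p
    using step_like_Lp[OF step_like_indicator posP[OF that]] .
  from A[unfolded borel] show ?thesis
  proof (induction rule: sigma_sets_induct_disjoint[OF int sub, consumes 1, case_names basic empty compl union])
    case (basic A)
    then obtain a b where "A = {a<..b}" by auto
    \<comment> \<open>The intersection may be empty; \<open>step_like_indicator\<close> does not
      assume its endpoints ordered.\<close>
    then have "A \<inter> {u<..v} = {max a u<..min b v}" by auto
    then show ?case using step_approximable_step_like[OF step_like_indicator, of "max a u" "min b v"] by simp
  next
    case empty
    have "(indicator ({} \<inter> {u<..v}) :: real \<Rightarrow> real) = (\<lambda>x. 0)" by auto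
    then show ?case using step_approximable_step_like[OF step_like_zero] by simp
  next
    case (compl A)
    have "(indicator ((UNIV - A) \<inter> {u<..v}) :: real \<Rightarrow> real)
        = (\<lambda>x. indicator {u<..v} x + (- 1) * indicator (A \<inter> {u<..v}) x)"
      by (auto simp: indicator_def fun_eq_iff)
    then show ?case
      using step_approximable_add[OF step_approximable_step_like[OF step_like_indicator]
        step_approximable_scale[OF compl(2), of "-1"]] by simp
  next
    case (union A)
    have disj: "disjoint_family A" by fact
    have eq: "(\<Sum>i<n. indicator (A i \<inter> {u<..v}) x) = (indicator ((\<Union>i<n. A i) \<inter> {u<..v}) x :: real)" for n x
    proof -
      have "disjoint_family_on (\<lambda>i. A i \<inter> {u<..v}) {..<n}"
        using disj by (fastforce simp: disjoint_family_on_def)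
      then have "(indicator (\<Union>i<n. A i \<inter> {u<..v}) x :: real) = (\<Sum>i<n. indicator (A i \<inter> {u<..v}) x)"
        by (intro indicator_UN_disjoint) auto
      then show ?thesis by simp
    qed
    show ?case
    proof (rule step_approximable_limit)
      show "step_approximable P (\<lambda>x. \<Sum>i<n. indicator (A i \<inter> {u<..v}) x)" for n
        using union by (intro step_approximable_sum) auto
      show "(\<lambda>n. \<Sum>i<n. indicator (A i \<inter> {u<..v}) x) \<longlonglongrightarrow> (indicator ((\<Union>i. A i) \<inter> {u<..v}) x :: real)" for x
      proof -
        have "(\<lambda>n. indicator (\<Union>i<n. A i \<inter> {u<..v}) x :: real) \<longlonglongrightarrow> indicator (\<Union>i. A i \<inter> {u<..v}) x"
          by (rule LIMSEQ_indicator_UN)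
        then show ?thesis unfolding eq by simp
      qed
      show "\<bar>\<Sum>i<n. indicator (A i \<inter> {u<..v}) x\<bar> \<le> (indicator {u<..v} x :: real)" for n x
        unfolding eq by (auto simp: indicator_def)
      show "indicator {u<..v} \<in> Lp lborel p" if "p \<in> P" for p using w[OF that] .
      have "(\<Union>i. A i) \<in> sets borel"
        unfolding borel using union by (intro sigma_sets.Union) auto
      then show "indicator ((\<Union>i. A i) \<inter> {u<..v}) \<in> borel_measurable borel" by measurable
    qed
  qed
qed

lemma step_approximable_indicator:
  assumes A: "A \<in> sets borel" and int: "integrable lborel (indicator A :: real \<Rightarrow> real)"
  shows "step_approximable P (indicator A)"
proof (rule step_approximable_limit)
  show "step_approximable P (indicator (A \<inter> {- real n<..real n}))" for n
    by (rule step_approximable_bounded_indicator[OF A])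
  show "(\<lambda>n. indicator (A \<inter> {- real n<..real n}) x) \<longlonglongrightarrow> indicator A x" for x
  proof (rule tendsto_eventually)
    obtain N where N: "\<bar>x\<bar> < real N" using reals_Archimedean2 by blast
    show "\<forall>\<^sub>F n in sequentially. indicator (A \<inter> {- real n<..real n}) x = indicator A x"
      using eventually_ge_at_top[of N]
    proof eventually_elim
      case (elim n)
      then have "\<bar>x\<bar> < real n" using N by linarith
      then show ?case by (auto simp: indicator_def)
    qed
  qed
  show "\<bar>indicator (A \<inter> {- real n<..real n}) x\<bar> \<le> (indicator A x :: real)" for n x
    by (auto simp: indicator_def)
  show "indicator A \<in> Lp lborel p" if "p \<in> P" for p
    by (rule indicator_Lp[OF posP[OF that] int])
  show "indicator A \<in> borel_measurable borel" using A by simp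
qed

text \<open>Simple functions converge to \<open>f\<close> under the majorant
  \<open>2 * \<bar>f x\<bar>\<close>, which lies in every \<open>Lp lborel p\<close> concerned.
  Exponent 1 makes them integrable, so their level sets for nonzero values have finite
  measure.\<close>

lemma step_approximable_Lp:
  assumes "1 \<in> P" and f: "\<And>p. p \<in> P \<Longrightarrow> f \<in> Lp lborel p"
  shows "step_approximable P f"
proof -
  have fm: "f \<in> borel_measurable lborel" and "integrable lborel (\<lambda>x. \<bar>f x\<bar>)"
    using f[OF \<open>1 \<in> P\<close>] by (simp_all add: Lp_def)
  then have fi: "integrable lborel f"
    using integrable_norm_iff[OF fm] by simp
  obtain F where F: "\<And>i. simple_function lborel (F i)" "\<And>x. (\<lambda>i. F i x) \<longlonglongrightarrow> f x"
    "\<And>i x. \<bar>F i x\<bar> \<le> 2 * \<bar>f x\<bar>"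
    using borel_measurable_implies_sequence_metric[OF fm, of 0] by auto
  show ?thesis
  proof (rule step_approximable_limit[OF _ F(2)])
    show "\<bar>F i x\<bar> \<le> 2 * \<bar>f x\<bar>" for i x by (rule F(3))
    show "(\<lambda>x. 2 * \<bar>f x\<bar>) \<in> Lp lborel p" if "p \<in> P" for p
      using f[OF that] by (auto simp: Lp_def powr_mult)
    show "f \<in> borel_measurable borel" using fm by simp
    fix i
    have Fm: "F i \<in> borel_measurable lborel" using F(1) by (rule borel_measurable_simple_function)
    have fin: "finite (range (F i))" using simple_functionD(1)[OF F(1)] by simp
    have Fi: "integrable lborel (F i)"
      by (rule Bochner_Integration.integrable_bound[of _ "\<lambda>x. 2 * \<bar>f x\<bar>"])
        (use fi Fm F(3) in auto)
    have meas: "F i -` {y} \<in> sets borel" for y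
      using measurable_sets[OF Fm, of "{y}"] by simp
    have eq: "F i = (\<lambda>x. \<Sum>y\<in>range (F i). y * indicator (F i -` {y}) x)"
    proof
      fix x
      have "(\<Sum>y\<in>range (F i). y * indicator (F i -` {y}) x) = (\<Sum>y\<in>range (F i). if y = F i x then y else 0)"
        by (intro sum.cong) (auto simp: indicator_def)
      then show "F i x = (\<Sum>y\<in>range (F i). y * indicator (F i -` {y}) x)"
        using fin by simp
    qed
    have "step_approximable P (\<lambda>x. y * indicator (F i -` {y}) x)" for y
    proof (cases "y = 0")
      case True
      then show ?thesis using step_approximable_step_like[OF step_like_zero] by simp
    next
      case False
      have "integrable lborel (indicator (F i -` {y}) :: real \<Rightarrow> real)"
      proof (rule Bochner_Integration.integrable_bound)
        \<comment> \<open>A Chebyshev bound: on the level set the quotient is 1. The level set of 0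
          may have infinite measure, but its term vanishes.\<close>
        show "integrable lborel (\<lambda>x. F i x / y)" using Fi by simp
        show "indicator (F i -` {y}) \<in> borel_measurable lborel" using meas by simp
        show "AE x in lborel. norm (indicator (F i -` {y}) x :: real) \<le> norm (F i x / y)"
          using False by (auto simp: indicator_def)
      qed
      then show ?thesis
        by (intro step_approximable_scale step_approximable_indicator meas)
    qed
    then show "step_approximable P (F i)"
      by (subst eq) (rule step_approximable_sum)
  qed
qed

end

subsection \<open>Integration with respect to the fractional motion\<close>

text \<open>This identifies the integral selected by \<open>SOME\<close> with an explicit limit, up
  to a null set.\<close>

lemma tendsto_Lp_unique:
  assumes p: "0 < p" and Y: "tendsto_Lp M p X Y" and Z: "tendsto_Lp M p X Z"
  shows "AE \<omega> in M. Y \<omega> = Z \<omega>"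
proof -
  have p0: "0 \<le> p" using p by simp
  have X: "X k \<in> Lp M p" for k using Y by (simp add: tendsto_Lp_def)
  have YL: "Y \<in> Lp M p" and ZL: "Z \<in> Lp M p" using Y Z by (simp_all add: tendsto_Lp_def)
  have le: "(\<integral>\<omega>. \<bar>Y \<omega> - Z \<omega>\<bar> powr p \<partial>M)
      \<le> 2 powr p * ((\<integral>\<omega>. \<bar>X k \<omega> - Y \<omega>\<bar> powr p \<partial>M) + (\<integral>\<omega>. \<bar>X k \<omega> - Z \<omega>\<bar> powr p \<partial>M))" for k
    using Lp_add(2)[OF p0 Lp_diff[OF p0 YL X[of k]] Lp_diff[OF p0 X[of k] ZL]]
    by (simp add: abs_minus_commute)
  have "(\<lambda>k. 2 powr p * ((\<integral>\<omega>. \<bar>X k \<omega> - Y \<omega>\<bar> powr p \<partial>M) + (\<integral>\<omega>. \<bar>X k \<omega> - Z \<omega>\<bar> powr p \<partial>M)))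
      \<longlonglongrightarrow> 2 powr p * (0 + 0)"
    using Y Z by (intro tendsto_intros) (simp_all add: tendsto_Lp_def)
  then have "(\<integral>\<omega>. \<bar>Y \<omega> - Z \<omega>\<bar> powr p \<partial>M) \<le> 2 powr p * (0 + 0)"
    by (rule LIMSEQ_le_const) (use le in blast)
  moreover have "0 \<le> (\<integral>\<omega>. \<bar>Y \<omega> - Z \<omega>\<bar> powr p \<partial>M)" by simp
  ultimately have "(\<integral>\<omega>. \<bar>Y \<omega> - Z \<omega>\<bar> powr p \<partial>M) = 0" by simp
  then have "AE \<omega> in M. \<bar>Y \<omega> - Z \<omega>\<bar> powr p = 0"
    using Lp_integrable[OF Lp_diff[OF p0 YL ZL]] by (subst (asm) integral_nonneg_eq_0_iff_AE) auto
  then show ?thesis by simp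
qed

context
  fixes M :: "'a measure" and L :: "real \<Rightarrow> 'a \<Rightarrow> real" and J :: "(real \<Rightarrow> real) \<Rightarrow> 'a \<Rightarrow> real"
    and \<alpha> :: real
  assumes prob: "prob_space M" and \<alpha>: "1 < \<alpha>" and L: "sas_process M \<alpha> L"
    and J: "stable_integral M \<alpha> L J"
begin

lemma stable_integral_lincomb:
  assumes "f \<in> Lp lborel \<alpha>" "h \<in> Lp lborel \<alpha>"
  shows "AE \<omega> in M. J (\<lambda>x. a * f x + b * h x) \<omega> = a * J f \<omega> + b * J h \<omega>"
  using J assms unfolding stable_integral_def by blast

lemma stable_integral_sum:
  assumes "\<And>i. i \<in> I \<Longrightarrow> f i \<in> Lp lborel \<alpha>"
  shows "AE \<omega> in M. J (\<lambda>x. \<Sum>i\<in>I. a i * f i x) \<omega> = (\<Sum>i\<in>I. a i * J (f i) \<omega>)"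
proof -
  \<comment> \<open>Both coefficients of the linearity condition are taken to be 0.\<close>
  have zero: "AE \<omega> in M. J (\<lambda>x. 0) \<omega> = 0"
    using stable_integral_lincomb[OF Lp_zero Lp_zero, of 0 0] by simp
  show ?thesis
    using assms
  proof (induction I rule: infinite_finite_induct)
    case (insert i I)
    have "(\<lambda>x. \<Sum>i\<in>I. a i * f i x) \<in> Lp lborel \<alpha>"
      using insert \<alpha> by (intro Lp_sum) auto
    then have "AE \<omega> in M. J (\<lambda>x. a i * f i x + 1 * (\<Sum>i\<in>I. a i * f i x)) \<omega>
        = a i * J (f i) \<omega> + 1 * J (\<lambda>x. \<Sum>i\<in>I. a i * f i x) \<omega>"
      using insert by (intro stable_integral_lincomb) auto
    moreover have "AE \<omega> in M. J (\<lambda>x. \<Sum>i\<in>I. a i * f i x) \<omega> = (\<Sum>i\<in>I. a i * J (f i) \<omega>)"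
      using insert by auto
    ultimately show ?case
    proof eventually_elim
      case (elim \<omega>)
      then show ?case using insert.hyps by simp
    qed
  qed (use zero in simp_all)
qed

text \<open>Up to a constant factor, \<open>J\<close> carries the \<alpha>-norm of the integrand to
  the \<open>p\<close>-norm of the random variable. Convergence of integrands thus becomes
  convergence of integrals.\<close>

lemma stable_integral_moment:
  assumes p: "0 < p" "p < \<alpha>" and f: "f \<in> Lp lborel \<alpha>"
  shows "J f \<in> Lp M p"
    and "(\<integral>\<omega>. \<bar>J f \<omega>\<bar> powr p \<partial>M)
      = (\<integral>x. \<bar>f x\<bar> powr \<alpha> \<partial>lborel) powr (p / \<alpha>) * (\<integral>\<omega>. \<bar>L 1 \<omega>\<bar> powr p \<partial>M)"
proof -
  interpret prob_space M by (rule prob)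
  have Lm[measurable]: "L t \<in> borel_measurable M" for t
    using L by (simp add: sas_process_def)
  \<comment> \<open>The process is specified through its increments; \<open>L 0 = 0\<close> almost
    surely passes the law of the increment to \<open>L 1\<close>.\<close>
  have "distr M borel (\<lambda>\<omega>. L 1 \<omega> - L 0 \<omega>) = distr M borel (L 1)"
    by (rule distr_cong_AE) (use L in \<open>auto simp: sas_process_def\<close>)
  moreover have "char (distr M borel (\<lambda>\<omega>. L 1 \<omega> - L 0 \<omega>)) \<theta>
      = complex_of_real (exp (- ((1 - 0) * \<bar>\<theta>\<bar> powr \<alpha>)))" for \<theta>
    using L unfolding sas_process_def by (metis zero_less_one)
  ultimately have cL: "char (distr M borel (L 1)) \<theta> = complex_of_real (exp (- (\<bar>\<theta>\<bar> powr \<alpha>)))" for \<theta>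
    by simp
  have Jm: "J f \<in> borel_measurable M"
    and cJ: "\<And>\<theta>. char (distr M borel (J f)) \<theta>
      = complex_of_real (exp (- (\<bar>\<theta>\<bar> powr \<alpha> * (\<integral>x. \<bar>f x\<bar> powr \<alpha> \<partial>lborel))))"
    using J f unfolding stable_integral_def by blast+
  have "0 \<le> (\<integral>x. \<bar>f x\<bar> powr \<alpha> \<partial>lborel)" by simp
  note * = stable_absolute_moment[OF Lm Jm p this cL cJ]
  show "J f \<in> Lp M p"
    and "(\<integral>\<omega>. \<bar>J f \<omega>\<bar> powr p \<partial>M)
      = (\<integral>x. \<bar>f x\<bar> powr \<alpha> \<partial>lborel) powr (p / \<alpha>) * (\<integral>\<omega>. \<bar>L 1 \<omega>\<bar> powr p \<partial>M)"
    by (fact *)+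
qed

section \<open>From step functions to general integrands\<close>

context
  fixes d p :: real
  assumes d: "0 < d" "d < 1 - 1 / \<alpha>" and p: "0 < p" "p < \<alpha>"
begin

lemma RL_right_Lp:
  assumes "h \<in> Lp lborel 1" "h \<in> Lp lborel \<alpha>"
  shows "RL_right d h \<in> Lp lborel \<alpha>"
  using RL_right_Lp_bound[OF \<alpha> d] assms by metis

lemma RL_right_indicator_Lp: "RL_right d (indicator {s<..t}) \<in> Lp lborel \<alpha>"
  using step_like_Lp[OF step_like_indicator] \<alpha> by (intro RL_right_Lp) auto

text \<open>The two powers grow as \<open>x\<close> tends to minus infinity, and only their
  difference is in the space. It is a multiple of the fractional integral of the indicator of the
  interval between 0 and \<open>t\<close>, with a minus sign for negative \<open>t\<close>.\<close>

lemma lfsm_kernel_Lp: "(\<lambda>x. max (t - x) 0 powr d - max (- x) 0 powr d) \<in> Lp lborel \<alpha>"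
proof -
  have "0 < Gamma (d + 1)"
    by (rule Gamma_real_pos) (use d in simp)
  then have G: "Gamma (d + 1) \<noteq> 0" by simp
  have "(\<lambda>x. max (t - x) 0 powr d - max (- x) 0 powr d)
      = (if 0 \<le> t then (\<lambda>x. Gamma (d + 1) * RL_right d (indicator {0<..t}) x)
         else (\<lambda>x. - Gamma (d + 1) * RL_right d (indicator {t<..0}) x))"
    using G by (auto simp: RL_right_indicator(2)[OF d(1)])
  then show ?thesis
    by (cases "0 \<le> t") (simp_all only: if_True if_False Lp_scale[OF RL_right_indicator_Lp])
qed

lemma step_integral_lfsm_Lp: "step_integral (lfsm J d) n a t \<in> Lp M p"
proof -
  have "lfsm J d u \<in> Lp M p" for u
    unfolding lfsm_def[abs_def] by (rule Lp_scale[OF stable_integral_moment(1)[OF p lfsm_kernel_Lp]])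
  then show ?thesis
    unfolding step_integral_def[abs_def] using p by (intro Lp_sum Lp_diff) auto
qed

lemma step_integral_lfsm:
  assumes t: "strict_mono_on {1..n} t"
  shows "AE \<omega> in M. step_integral (lfsm J d) n a t \<omega> = J (RL_right d (step_fun n a t)) \<omega>"
proof -
  let ?f = "\<lambda>t x. max (t - x) 0 powr d - max (- x) 0 powr d"
  let ?h = "\<lambda>i. RL_right d (indicator {t i<..t (i + 1)})"
  have le: "t i \<le> t (i + 1)" if "i \<in> {1..<n}" for i
    using strict_mono_onD[OF t, of i "i + 1"] that by auto
  have "AE \<omega> in M. J (?h i) \<omega> = lfsm J d (t (i + 1)) \<omega> - lfsm J d (t i) \<omega>" if "i \<in> {1..<n}" for i
  proof -
    \<comment> \<open>The terms in \<open>max (- x) 0\<close> cancel; they are inserted so that both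
      summands are kernels of the motion and lie in the domain of \<open>J\<close>.\<close>
    have "?h i = (\<lambda>x. 1 / Gamma (d + 1) * ?f (t (i + 1)) x + - (1 / Gamma (d + 1)) * ?f (t i) x)"
      unfolding fun_eq_iff RL_right_indicator(2)[OF d(1) le[OF that]] by (simp add: algebra_simps)
    then show ?thesis
      using stable_integral_lincomb[OF lfsm_kernel_Lp[of "t (i + 1)"] lfsm_kernel_Lp[of "t i"],
        of "1 / Gamma (d + 1)" "- (1 / Gamma (d + 1))"]
      by (simp add: lfsm_def)
  qed
  then have "AE \<omega> in M. \<forall>i\<in>{1..<n}. J (?h i) \<omega> = lfsm J d (t (i + 1)) \<omega> - lfsm J d (t i) \<omega>"
    by (intro AE_finite_allI) auto
  moreover have "AE \<omega> in M. J (\<lambda>x. \<Sum>i\<in>{1..<n}. a i * ?h i x) \<omega> = (\<Sum>i\<in>{1..<n}. a i * J (?h i) \<omega>)"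
    by (rule stable_integral_sum) (rule RL_right_indicator_Lp)
  moreover have "RL_right d (step_fun n a t) = (\<lambda>x. \<Sum>i\<in>{1..<n}. a i * ?h i x)"
    using RL_right_step_fun[OF d(1) t] by blast
  ultimately show ?thesis
    by (auto simp: step_integral_def)
qed

text \<open>Both integrals are values of \<open>J\<close>, so their difference is \<open>J\<close>
  of a difference and its moment is known exactly. The two factors of \<open>frac_norm\<close>,
  raised to the power \<open>p\<close>, are the moment of \<open>L 1\<close> and the scale with
  exponent \<open>p / \<alpha>\<close>.\<close>

lemma step_integral_lfsm_dist:
  assumes t: "strict_mono_on {1..n} t" and g: "g \<in> Lp lborel 1" "g \<in> Lp lborel \<alpha>"
  shows "(\<integral>\<omega>. \<bar>step_integral (lfsm J d) n a t \<omega> - J (RL_right d g) \<omega>\<bar> powr p \<partial>M)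
    = frac_norm M L \<alpha> d p (\<lambda>x. step_fun n a t x - g x) powr p"
proof -
  define \<phi> where "\<phi> = step_fun n a t"
  have \<phi>: "\<phi> \<in> Lp lborel 1" "\<phi> \<in> Lp lborel \<alpha>"
    using \<alpha> by (auto simp: \<phi>_def intro!: step_fun_Lp)
  note R\<phi> = RL_right_Lp[OF \<phi>] and Rg = RL_right_Lp[OF g]
  have \<alpha>0: "0 \<le> \<alpha>" using \<alpha> by simp
  define h where "h = (\<lambda>x. RL_right d \<phi> x - RL_right d g x)"
  have h: "h \<in> Lp lborel \<alpha>" unfolding h_def by (intro Lp_diff \<alpha>0 R\<phi> Rg)
  have [measurable]: "\<phi> \<in> borel_measurable borel" "g \<in> borel_measurable borel"
    using \<phi> g by (simp_all add: Lp_def)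
  note [measurable] = RL_right_measurable[of \<phi> d] RL_right_measurable[of g d]
    RL_right_measurable[of "\<lambda>x. \<phi> x - g x" d]
  \<comment> \<open>Additivity can fail on a null set because of the default value 0; the integral
    in \<open>frac_norm\<close> does not see it.\<close>
  have "AE x in lborel. RL_right d (\<lambda>x. \<phi> x - g x) x = h x"
    using RL_right_integrable_AE[OF \<alpha> d \<phi>] RL_right_integrable_AE[OF \<alpha> d g]
    by eventually_elim (simp add: h_def RL_right_def left_diff_distrib right_diff_distrib)
  then have eq: "(\<integral>x. \<bar>RL_right d (\<lambda>x. \<phi> x - g x) x\<bar> powr \<alpha> \<partial>lborel) = (\<integral>x. \<bar>h x\<bar> powr \<alpha> \<partial>lborel)"
    by (intro integral_cong_AE) (auto simp: h_def)
  have "AE \<omega> in M. J h \<omega> = J (RL_right d \<phi>) \<omega> - J (RL_right d g) \<omega>"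
    using stable_integral_lincomb[OF R\<phi> Rg, of 1 "-1"] by (simp add: h_def)
  then have ae: "AE \<omega> in M. step_integral (lfsm J d) n a t \<omega> - J (RL_right d g) \<omega> = J h \<omega>"
    using step_integral_lfsm[OF t, of a] by eventually_elim (simp add: \<phi>_def)
  have [measurable]: "J h \<in> borel_measurable M" "J (RL_right d g) \<in> borel_measurable M"
    "step_integral (lfsm J d) n a t \<in> borel_measurable M"
    using stable_integral_moment(1)[OF p h] stable_integral_moment(1)[OF p Rg]
      step_integral_lfsm_Lp by (simp_all add: Lp_def)
  have "(\<integral>\<omega>. \<bar>step_integral (lfsm J d) n a t \<omega> - J (RL_right d g) \<omega>\<bar> powr p \<partial>M)
      = (\<integral>\<omega>. \<bar>J h \<omega>\<bar> powr p \<partial>M)"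
    using ae by (intro integral_cong_AE) auto
  also have "\<dots> = frac_norm M L \<alpha> d p (\<lambda>x. \<phi> x - g x) powr p"
    using p \<alpha> by (simp add: stable_integral_moment(2)[OF p h] frac_norm_def eq powr_mult powr_powr
      integral_nonneg_AE)
  finally show ?thesis by (simp add: \<phi>_def)
qed

text \<open>Without an approximating sequence the condition on all such sequences would be vacuous
  and would not determine the integral. Approximation in both norms at rate
  \<open>1 / real (Suc k)\<close> suffices by \<open>RL_right_Lp_bound\<close>.\<close>

lemma step_approx_exists:
  assumes g: "g \<in> Lp lborel 1" "g \<in> Lp lborel \<alpha>"
  shows "\<exists>n a t. step_approx M L \<alpha> d p g n a t"
proof -
  obtain C where C: "0 \<le> C"
    "\<And>h. h \<in> Lp lborel 1 \<Longrightarrow> h \<in> Lp lborel \<alpha> \<Longrightarrow>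
      (\<integral>x. \<bar>RL_right d h x\<bar> powr \<alpha> \<partial>lborel)
        \<le> C * ((\<integral>x. \<bar>h x\<bar> \<partial>lborel) powr \<alpha> + (\<integral>x. \<bar>h x\<bar> powr \<alpha> \<partial>lborel))"
    using RL_right_Lp_bound[OF \<alpha> d] by metis
  define \<epsilon> where "\<epsilon> = (\<lambda>k. 1 / real (Suc k))"
  have \<epsilon>: "0 < \<epsilon> k" for k by (simp add: \<epsilon>_def)
  have \<epsilon>0: "\<epsilon> \<longlonglongrightarrow> 0"
    unfolding \<epsilon>_def using LIMSEQ_Suc[OF lim_1_over_n] by simp
  have "step_approximable {1, \<alpha>} g"
    using \<alpha> g by (intro step_approximable_Lp) auto
  define Q where "Q = (\<lambda>k n a t. 2 \<le> n \<and> strict_mono_on {1..n} t \<and>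
      (\<integral>x. \<bar>step_fun n a t x - g x\<bar> \<partial>lborel) < \<epsilon> k \<and>
      (\<integral>x. \<bar>step_fun n a t x - g x\<bar> powr \<alpha> \<partial>lborel) < \<epsilon> k)"
  have "\<exists>n a t. Q k n a t" for k
  proof -
    obtain \<phi> where \<phi>: "step_like \<phi>"
      "\<forall>q\<in>{1, \<alpha>}. (\<integral>x. \<bar>\<phi> x - g x\<bar> powr q \<partial>lborel) < \<epsilon> k"
      using \<open>step_approximable {1, \<alpha>} g\<close> \<epsilon>[of k] unfolding step_approximable_def by blast
    obtain n a t where "2 \<le> n" "strict_mono_on {1..n} t" "\<phi> = step_fun n a t"
      using step_like_step_fun[OF \<phi>(1)] .
    with \<phi>(2) show ?thesis
      by (intro exI[of _ n] exI[of _ a] exI[of _ t]) (simp add: Q_def)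
  qed
  then obtain n a t where "\<And>k. Q k (n k) (a k) (t k)"
    by metis
  then have nat: "\<And>k. 2 \<le> n k" "\<And>k. strict_mono_on {1..n k} (t k)"
      "\<And>k. (\<integral>x. \<bar>step_fun (n k) (a k) (t k) x - g x\<bar> \<partial>lborel) < \<epsilon> k"
      "\<And>k. (\<integral>x. \<bar>step_fun (n k) (a k) (t k) x - g x\<bar> powr \<alpha> \<partial>lborel) < \<epsilon> k"
    unfolding Q_def by simp_all
  define h where "h = (\<lambda>k x. step_fun (n k) (a k) (t k) x - g x)"
  define S where "S = (\<lambda>k. \<integral>x. \<bar>RL_right d (h k) x\<bar> powr \<alpha> \<partial>lborel)"
  have h: "h k \<in> Lp lborel 1" "h k \<in> Lp lborel \<alpha>" for k
    using \<alpha> g by (auto simp: h_def intro!: Lp_diff step_fun_Lp)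
  have S0: "0 \<le> S k" for k by (simp add: S_def)
  have S1: "S k \<le> C * (\<epsilon> k powr \<alpha> + \<epsilon> k)" for k
  proof -
    have "(\<integral>x. \<bar>h k x\<bar> \<partial>lborel) powr \<alpha> \<le> \<epsilon> k powr \<alpha>"
      using nat(3)[of k] \<alpha> by (intro powr_mono2) (auto simp: h_def)
    moreover have "(\<integral>x. \<bar>h k x\<bar> powr \<alpha> \<partial>lborel) \<le> \<epsilon> k"
      using nat(4)[of k] by (simp add: h_def)
    ultimately show ?thesis
      unfolding S_def by (intro order_trans[OF C(2)[OF h]] mult_left_mono add_mono C(1))
  qed
  have pow: "(\<lambda>k. X k powr q) \<longlonglongrightarrow> 0" if "X \<longlonglongrightarrow> 0" "\<And>k. 0 \<le> X k" "0 < q" for X and q :: real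
    using tendsto_powr'[OF that(1) tendsto_const, of q] that by simp
  have "(\<lambda>k. C * (\<epsilon> k powr \<alpha> + \<epsilon> k)) \<longlonglongrightarrow> C * (0 + 0)"
    using \<alpha> \<epsilon> by (intro tendsto_intros pow \<epsilon>0) (auto simp: less_imp_le)
  then have "S \<longlonglongrightarrow> 0"
    by (intro tendsto_sandwich[OF _ _ tendsto_const, of 0 S]) (use S0 S1 in auto)
  then have "(\<lambda>k. S k powr (1 / \<alpha>)) \<longlonglongrightarrow> 0"
    using S0 \<alpha> by (intro pow) auto
  then have "(\<lambda>k. (\<integral>\<omega>. \<bar>L 1 \<omega>\<bar> powr p \<partial>M) powr (1 / p) * S k powr (1 / \<alpha>)) \<longlonglongrightarrow> 0"
    by (rule tendsto_mult_right_zero)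
  then have "step_approx M L \<alpha> d p g n a t"
    using nat by (simp add: step_approx_def frac_norm_def S_def h_def)
  then show ?thesis by blast
qed

text \<open>The distance formula holds for every approximating sequence, so existence of the limit
  and its independence of the sequence come together.\<close>

lemma has_lfsm_integral_RL_right:
  assumes g: "g \<in> Lp lborel 1" "g \<in> Lp lborel \<alpha>"
  shows "has_lfsm_integral M L J \<alpha> d p g (J (RL_right d g))"
  unfolding has_lfsm_integral_def
proof (intro conjI allI impI step_approx_exists[OF g])
  fix n a t assume A: "step_approx M L \<alpha> d p g n a t"
  have "(\<lambda>k. frac_norm M L \<alpha> d p (\<lambda>x. step_fun (n k) (a k) (t k) x - g x) powr p) \<longlonglongrightarrow> 0 powr p"
  proof (rule tendsto_powr')
    show "(\<lambda>k. frac_norm M L \<alpha> d p (\<lambda>x. step_fun (n k) (a k) (t k) x - g x)) \<longlonglongrightarrow> 0"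
      using A by (simp add: step_approx_def)
  qed (use p in \<open>auto simp: frac_norm_def\<close>)
  then show "tendsto_Lp M p (\<lambda>k. step_integral (lfsm J d) (n k) (a k) (t k)) (J (RL_right d g))"
    using A step_integral_lfsm_dist[OF _ g]
    by (simp add: tendsto_Lp_def step_approx_def step_integral_lfsm_Lp
      stable_integral_moment(1)[OF p RL_right_Lp[OF g]])
qed

end

end

theorem theorem3p2:
  fixes M :: "'a measure" and L :: "real \<Rightarrow> 'a \<Rightarrow> real"
    and J :: "(real \<Rightarrow> real) \<Rightarrow> 'a \<Rightarrow> real"
    and \<alpha> d p :: real and g :: "real \<Rightarrow> real"
  assumes "prob_space M"
    and "1 < \<alpha>" "\<alpha> < 2"
    and "0 < d" "d < 1 - 1 / \<alpha>"
    and "1 < p" "p < \<alpha>"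
    and "sas_process M \<alpha> L"
    and "stable_integral M \<alpha> L J"
    and "g \<in> Lp lborel 1 \<inter> Lp lborel \<alpha>"
  shows "lfsm_integral M L J \<alpha> d p g \<in> Lp M p \<and> J (RL_right d g) \<in> Lp M p \<and>
    (AE \<omega> in M. lfsm_integral M L J \<alpha> d p g \<omega> = J (RL_right d g) \<omega>)"
proof -
  have p: "0 < p" and g: "g \<in> Lp lborel 1" "g \<in> Lp lborel \<alpha>"
    using assms by auto
  have R: "has_lfsm_integral M L J \<alpha> d p g (J (RL_right d g))"
    by (rule has_lfsm_integral_RL_right[OF assms(1,2,8,9,4,5) p assms(7) g])
  \<comment> \<open>The witness \<open>R\<close> ensures that the choice by \<open>SOME\<close> has
    the defining property.\<close>
  then have I: "has_lfsm_integral M L J \<alpha> d p g (lfsm_integral M L J \<alpha> d p g)"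
    unfolding lfsm_integral_def by (rule someI[where P = "has_lfsm_integral M L J \<alpha> d p g"])
  \<comment> \<open>One common approximating sequence is enough to compare the two limits.\<close>
  obtain n a t where "step_approx M L \<alpha> d p g n a t"
    using R unfolding has_lfsm_integral_def by blast
  with R I have
    "tendsto_Lp M p (\<lambda>k. step_integral (lfsm J d) (n k) (a k) (t k)) (lfsm_integral M L J \<alpha> d p g)"
    "tendsto_Lp M p (\<lambda>k. step_integral (lfsm J d) (n k) (a k) (t k)) (J (RL_right d g))"
    unfolding has_lfsm_integral_def by blast+
  with tendsto_Lp_unique[OF p this] show ?thesis
    by (simp add: tendsto_Lp_def)
qed

end
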